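(* Let $Z$ be a metric space with covering dimension $\dim(Z) \leq n$. Let $F$ be a finite group that acts by isometries on $Z$. Then any open $F$-cover $\mathcal{U}$ of $Z$ has an open $F$-refinement $\mathcal{W}$ with $\dim(\mathcal{W}) \leq n$.
   Context: Let $G$ be a group acting on a topological space $Y$. A cover $\mathcal{U}$ of $Y$ is $G$-equivariant if $g\cdot U \in \mathcal{U}$ for all $g \in G$ and $U \in \mathcal{U}$. A $G$-cover is a $G$-equivariant cover $\mathcal{U}$ such that for all $g \in G$, $U \in \mathcal{U}$: if $g\cdot U \cap U \neq \emptyset$ then $g \cdot U = U$. A $G$-refinement of a cover is a refinement that is itself a $G$-cover (a cover $\mathcal{W}$ of $Y$ is a refinement of $\mathcal{U}$ if every $W\in\mathcal{W}$ is contained in some $U\in\mathcal{U}$). A cover or refinement is called open if all its members are open. A collection $\mathcal{W}$ of subsets has dimension $\dim(\mathcal{W}) \leq n$ if every point lies in at most $n+1$ members of $\mathcal{W}$. A space has covering dimension $\leq n$ if every finite open cover has a finite open refinement of dimension $\leq n$. *)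

theory Defs
  imports "HOL-Analysis.Analysis" "HOL-Algebra.Group_Action"
begin

text \<open>
  Covers are sets of subsets, not indexed families. A group action of \<open>G\<close> on a set \<open>Y\<close> is the
  library's \<^locale>\<open>group_action\<close>, so \<open>g \<cdot> U\<close> is the image \<open>\<phi> g ` U\<close>.
\<close>

definition cover_of :: "'a set \<Rightarrow> 'a set set \<Rightarrow> bool" where
  "cover_of Y \<U> \<longleftrightarrow> \<Union>\<U> = Y"

definition open_cover_of :: "'a topology \<Rightarrow> 'a set set \<Rightarrow> bool" where
  "open_cover_of X \<U> \<longleftrightarrow> cover_of (topspace X) \<U> \<and> (\<forall>U\<in>\<U>. openin X U)"

definition refinement_of :: "'a set \<Rightarrow> 'a set set \<Rightarrow> 'a set set \<Rightarrow> bool" where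
  "refinement_of Y \<U> \<W> \<longleftrightarrow> cover_of Y \<W> \<and> (\<forall>W\<in>\<W>. \<exists>U\<in>\<U>. W \<subseteq> U)"

text \<open>The finiteness conjunct is essential, since \<open>card\<close> is \<open>0\<close> on infinite sets.\<close>

definition collection_dim_le :: "'a set set \<Rightarrow> nat \<Rightarrow> bool" where
  "collection_dim_le \<W> n \<longleftrightarrow>
     (\<forall>x. finite {W \<in> \<W>. x \<in> W} \<and> card {W \<in> \<W>. x \<in> W} \<le> n + 1)"

definition covering_dim_le :: "'a topology \<Rightarrow> nat \<Rightarrow> bool" where
  "covering_dim_le X n \<longleftrightarrow>
     (\<forall>\<U>. finite \<U> \<and> open_cover_of X \<U> \<longrightarrow>
        (\<exists>\<W>. finite \<W> \<and> open_cover_of X \<W> \<and> refinement_of (topspace X) \<U> \<W> \<and>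
             collection_dim_le \<W> n))"

definition equivariant_cover ::
    "('g, 'm) monoid_scheme \<Rightarrow> ('g \<Rightarrow> 'a \<Rightarrow> 'a) \<Rightarrow> 'a set \<Rightarrow> 'a set set \<Rightarrow> bool" where
  "equivariant_cover G \<phi> Y \<U> \<longleftrightarrow>
     cover_of Y \<U> \<and> (\<forall>g\<in>carrier G. \<forall>U\<in>\<U>. \<phi> g ` U \<in> \<U>)"

definition G_cover ::
    "('g, 'm) monoid_scheme \<Rightarrow> ('g \<Rightarrow> 'a \<Rightarrow> 'a) \<Rightarrow> 'a set \<Rightarrow> 'a set set \<Rightarrow> bool" where
  "G_cover G \<phi> Y \<U> \<longleftrightarrow>
     equivariant_cover G \<phi> Y \<U> \<and>
     (\<forall>g\<in>carrier G. \<forall>U\<in>\<U>. \<phi> g ` U \<inter> U \<noteq> {} \<longrightarrow> \<phi> g ` U = U)"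

definition G_refinement ::
    "('g, 'm) monoid_scheme \<Rightarrow> ('g \<Rightarrow> 'a \<Rightarrow> 'a) \<Rightarrow> 'a set \<Rightarrow> 'a set set \<Rightarrow> 'a set set \<Rightarrow> bool" where
  "G_refinement G \<phi> Y \<U> \<W> \<longleftrightarrow> refinement_of Y \<U> \<W> \<and> G_cover G \<phi> Y \<W>"

definition isometric_action ::
    "('g, 'm) monoid_scheme \<Rightarrow> 'a set \<Rightarrow> ('a \<Rightarrow> 'a \<Rightarrow> real) \<Rightarrow> ('g \<Rightarrow> 'a \<Rightarrow> 'a) \<Rightarrow> bool" where
  "isometric_action G M d \<phi> \<longleftrightarrow>
     group_action G M \<phi> \<and> (\<forall>g\<in>carrier G. \<forall>x\<in>M. \<forall>y\<in>M. d (\<phi> g x) (\<phi> g y) = d x y)"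

end

theory Submission
  imports Defs
begin

text \<open>
  The orbit space of \<open>F\<close> is metric, and it suffices to show that every open cover of it has an open
  shrinking of order at most \<open>n + 1\<close>, because such a shrinking pulls back to \<open>Z\<close> and can be
  intersected with the members of \<open>\<U>\<close>. Let \<open>C k\<close> be the closed set of orbits with at most \<open>k\<close> points.
  On \<open>C (k + 1) - C k\<close> the orbit map is locally an isometry, so small closed subsets there have
  covering dimension at most \<open>n\<close>. Using the \<open>\<sigma>\<close>-discrete locally finite refinements of M. E. Rudin,
  one reduces the order of a cover to \<open>n + 1\<close> first on \<open>C 1\<close>, then on \<open>C 2\<close>, and so on up to \<open>C |F|\<close>.
\<close>


section \<open>Covering dimension and shrinkings\<close>

text \<open>The obstacle is that \<open>covering_dim_le\<close> speaks of finite covers only, while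
  \<open>\<U>\<close> and its image in the orbit space may be infinite. The hypothesis can thus be
  used only on pieces that meet finitely many members, and the pieces are kept closed because the
  bound passes to closed subspaces by an elementary argument. A disjoint, locally finite family of
  closed pieces can be treated at once, since changes made on different pieces do not interfere. The
  orbits are sorted by size because the orbit map need not have local sections where stabilizers
  jump, as at the centre of a half-turn of the plane. Covers in the orbit space are families over a
  fixed index type rather than sets of sets: an index survives every shrinking, so decreasing
  sequences of covers have a limit, and repeated sets count with multiplicity, which only
  strengthens the bound.\<close>

definition order_at_le :: "('i \<Rightarrow> 'a set) \<Rightarrow> nat \<Rightarrow> 'a \<Rightarrow> bool" where
  "order_at_le V n x \<longleftrightarrow> finite {i. x \<in> V i} \<and> card {i. x \<in> V i} \<le> n + 1"

lemma order_at_le_mono: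
  assumes "order_at_le V n x" "\<And>i. y \<in> W i \<Longrightarrow> x \<in> V i"
  shows "order_at_le W n y"
proof -
  have "{i. y \<in> W i} \<subseteq> {i. x \<in> V i}"
    using assms(2) by blast
  then show ?thesis
    using assms(1) unfolding order_at_le_def by (meson card_mono finite_subset le_trans)
qed

text \<open>Indices are counted, not sets, so that local finiteness also controls the order of the
  family.\<close>

definition locally_finite_family :: "'a topology \<Rightarrow> ('i \<Rightarrow> 'a set) \<Rightarrow> bool" where
  "locally_finite_family X V \<longleftrightarrow>
     (\<forall>x\<in>topspace X. \<exists>N. openin X N \<and> x \<in> N \<and> finite {i. V i \<inter> N \<noteq> {}})"

lemma locally_finite_family_mono:
  assumes "locally_finite_family X V" "\<And>i. W i \<subseteq> V i"
  shows "locally_finite_family X W"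
  unfolding locally_finite_family_def
proof
  fix x assume "x \<in> topspace X"
  then obtain N where N: "openin X N" "x \<in> N" "finite {i. V i \<inter> N \<noteq> {}}"
    using assms(1) unfolding locally_finite_family_def by blast
  moreover have "{i. W i \<inter> N \<noteq> {}} \<subseteq> {i. V i \<inter> N \<noteq> {}}"
    using assms(2) by blast
  ultimately show "\<exists>N. openin X N \<and> x \<in> N \<and> finite {i. W i \<inter> N \<noteq> {}}"
    by (meson finite_subset)
qed

lemma locally_finite_family_reindex:
  assumes "locally_finite_family X V" "inj f"
  shows "locally_finite_family X (\<lambda>j. V (f j))"
  unfolding locally_finite_family_def
proof
  fix x assume "x \<in> topspace X"
  then obtain N where N: "openin X N" "x \<in> N" "finite {i. V i \<inter> N \<noteq> {}}"
    using assms(1) unfolding locally_finite_family_def by blast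
  have "finite (f -` {i. V i \<inter> N \<noteq> {}})"
    using N(3) assms(2) by (rule finite_vimageI)
  moreover have "f -` {i. V i \<inter> N \<noteq> {}} = {j. V (f j) \<inter> N \<noteq> {}}"
    by auto
  ultimately show "\<exists>N. openin X N \<and> x \<in> N \<and> finite {j. V (f j) \<inter> N \<noteq> {}}"
    using N by metis
qed

lemma closedin_UN_locally_finite_family:
  assumes "locally_finite_family X K" "\<And>i. closedin X (K i)"
  shows "closedin X (\<Union>i\<in>I. K i)"
proof (rule closedin_locally_finite_Union)
  show "locally_finite_in X (K ` I)"
    unfolding locally_finite_in_def
  proof (intro conjI ballI)
    show "\<Union> (K ` I) \<subseteq> topspace X"
      using assms(2) closedin_subset by blast
    fix x assume "x \<in> topspace X"
    then obtain N where N: "openin X N" "x \<in> N" "finite {i. K i \<inter> N \<noteq> {}}"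
      using assms(1) unfolding locally_finite_family_def by blast
    have "{A \<in> K ` I. A \<inter> N \<noteq> {}} \<subseteq> K ` {i. K i \<inter> N \<noteq> {}}"
      by blast
    then show "\<exists>N. openin X N \<and> x \<in> N \<and> finite {A \<in> K ` I. A \<inter> N \<noteq> {}}"
      using N by (meson finite_imageI finite_subset)
  qed
qed (use assms(2) in auto)

text \<open>By local finiteness the members that miss \<open>x\<close> have a closed union; off this
  union a point lies only in members that contain \<open>x\<close>. This is how a bound on a closed
  set spreads to a neighbourhood.\<close>

lemma openin_order_at_le:
  assumes "locally_finite_family X K" "\<And>i. closedin X (K i)"
  shows "openin X {x \<in> topspace X. order_at_le K n x}"
proof (subst openin_subopen, intro ballI)
  fix x assume "x \<in> {x \<in> topspace X. order_at_le K n x}"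
  then have x: "x \<in> topspace X" "order_at_le K n x"
    by auto
  let ?G = "topspace X - (\<Union>i\<in>{i. x \<notin> K i}. K i)"
  have "openin X ?G"
    using closedin_UN_locally_finite_family[OF assms] by blast
  moreover have "x \<in> ?G"
    using x by blast
  moreover have "order_at_le K n y" if "y \<in> ?G" for y
    using x(2) by (rule order_at_le_mono) (use that in blast)
  ultimately show "\<exists>T. openin X T \<and> x \<in> T \<and> T \<subseteq> {x \<in> topspace X. order_at_le K n x}"
    by (intro exI[of _ ?G]) auto
qed

text \<open>A cover of \<open>C\<close> is extended to open sets of \<open>X\<close> and completed
  by the complement of \<open>C\<close>. A member of the refinement that meets \<open>C\<close>
  cannot lie in that complement, so its trace lies in a member of the given cover; taking traces can
  only merge sets.\<close>

lemma covering_dim_le_closed_subspace: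
  assumes "closedin X C" "covering_dim_le X n"
  shows "covering_dim_le (subtopology X C) n"
  unfolding covering_dim_le_def
proof (intro allI impI, elim conjE)
  have C: "C \<subseteq> topspace X"
    using assms(1) closedin_subset by blast
  fix \<U> assume fin: "finite \<U>" and \<U>: "open_cover_of (subtopology X C) \<U>"
  have "\<forall>U\<in>\<U>. \<exists>E. openin X E \<and> E \<inter> C = U"
    using \<U> unfolding open_cover_of_def openin_subtopology by metis
  then obtain E where E: "\<And>U. U \<in> \<U> \<Longrightarrow> openin X (E U)" "\<And>U. U \<in> \<U> \<Longrightarrow> E U \<inter> C = U"
    by metis
  have \<U>C: "\<Union>\<U> = C"
    using \<U> C by (auto simp: open_cover_of_def cover_of_def)
  have "open_cover_of X (insert (topspace X - C) (E ` \<U>))"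
    unfolding open_cover_of_def cover_of_def
  proof (intro conjI ballI)
    show "\<Union> (insert (topspace X - C) (E ` \<U>)) = topspace X"
    proof
      show "\<Union> (insert (topspace X - C) (E ` \<U>)) \<subseteq> topspace X"
        using openin_subset[OF E(1)] by blast
      show "topspace X \<subseteq> \<Union> (insert (topspace X - C) (E ` \<U>))"
      proof
        fix x assume "x \<in> topspace X"
        moreover have "x \<in> \<Union>(E ` \<U>)" if "x \<in> C"
        proof -
          obtain U where "U \<in> \<U>" "x \<in> U"
            using \<open>x \<in> C\<close> \<U>C by blast
          then show ?thesis
            using E(2)[of U] by blast
        qed
        ultimately show "x \<in> \<Union> (insert (topspace X - C) (E ` \<U>))"
          by blast
      qed
    qed
    show "openin X U" if "U \<in> insert (topspace X - C) (E ` \<U>)" for U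
      using that E(1) assms(1) by auto
  qed
  then obtain \<W> where \<W>: "finite \<W>" "open_cover_of X \<W>"
      "refinement_of (topspace X) (insert (topspace X - C) (E ` \<U>)) \<W>" "collection_dim_le \<W> n"
    using assms(2) fin unfolding covering_dim_le_def by (meson finite_imageI finite_insert)
  let ?W = "(\<lambda>W. W \<inter> C) ` {W \<in> \<W>. W \<inter> C \<noteq> {}}"
  have cov: "\<Union>?W = C"
  proof -
    have "\<Union>\<W> = topspace X"
      using \<W>(2) by (simp add: open_cover_of_def cover_of_def)
    then show ?thesis
      using C by blast
  qed
  show "\<exists>\<W>. finite \<W> \<and> open_cover_of (subtopology X C) \<W> \<and>
          refinement_of (topspace (subtopology X C)) \<U> \<W> \<and> collection_dim_le \<W> n"
  proof (intro exI conjI)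
    show "finite ?W"
      using \<W>(1) by simp
    show "open_cover_of (subtopology X C) ?W"
      unfolding open_cover_of_def cover_of_def
      using cov C \<W>(2) by (auto simp: open_cover_of_def openin_subtopology)
    have "\<exists>U\<in>\<U>. W \<inter> C \<subseteq> U" if W: "W \<in> \<W>" "W \<inter> C \<noteq> {}" for W
    proof -
      obtain U where "U \<in> insert (topspace X - C) (E ` \<U>)" "W \<subseteq> U"
        using \<W>(3) W(1) unfolding refinement_of_def by blast
      then obtain U' where "U' \<in> \<U>" "W \<subseteq> E U'"
        using W(2) by blast
      then show ?thesis
        using E(2)[of U'] by blast
    qed
    then show "refinement_of (topspace (subtopology X C)) \<U> ?W"
      unfolding refinement_of_def cover_of_def using cov C by auto
    show "collection_dim_le ?W n"
      unfolding collection_dim_le_def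
    proof
      fix x
      have sub: "{V \<in> ?W. x \<in> V} \<subseteq> (\<lambda>W. W \<inter> C) ` {W \<in> \<W>. x \<in> W}"
        by blast
      have fin: "finite {W \<in> \<W>. x \<in> W}" and le: "card {W \<in> \<W>. x \<in> W} \<le> n + 1"
        using \<W>(4) unfolding collection_dim_le_def by auto
      show "finite {V \<in> ?W. x \<in> V} \<and> card {V \<in> ?W. x \<in> V} \<le> n + 1"
        using sub fin le by (meson card_image_le card_mono finite_imageI finite_subset le_trans)
    qed
  qed
qed

text \<open>A cover of \<open>Y\<close> is pulled back along \<open>f\<close>, refined in
  \<open>X\<close>, and pulled back along \<open>g\<close>; as \<open>f\<close> undoes
  \<open>g\<close>, the result refines the given cover, and a point \<open>y\<close> has at most the
  multiplicity of \<open>g y\<close>. The intended \<open>f\<close> is the orbit map and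
  \<open>g\<close> a section of it.\<close>

lemma covering_dim_le_retraction_maps:
  assumes "retraction_maps X Y f g" "covering_dim_le X n"
  shows "covering_dim_le Y n"
  unfolding covering_dim_le_def
proof (intro allI impI, elim conjE)
  have f: "continuous_map X Y f" and g: "continuous_map Y X g"
    and fg: "\<And>y. y \<in> topspace Y \<Longrightarrow> f (g y) = y"
    using assms(1) by (auto simp: retraction_maps_def)
  fix \<U> assume fin: "finite \<U>" and \<U>: "open_cover_of Y \<U>"
  let ?U = "(\<lambda>U. {x \<in> topspace X. f x \<in> U}) ` \<U>"
  have "\<exists>U\<in>\<U>. f x \<in> U" if "x \<in> topspace X" for x
  proof -
    have "f x \<in> topspace Y"
      using that continuous_map_image_subset_topspace[OF f] by blast
    then show ?thesis
      using \<U> by (metis UnionE cover_of_def open_cover_of_def)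
  qed
  then have "open_cover_of X ?U"
    using \<U> openin_continuous_map_preimage[OF f]
    by (auto simp: open_cover_of_def cover_of_def)
  then obtain \<W> where \<W>: "finite \<W>" "open_cover_of X \<W>"
      "refinement_of (topspace X) ?U \<W>" "collection_dim_le \<W> n"
    using assms(2) fin unfolding covering_dim_le_def by (meson finite_imageI)
  let ?W = "(\<lambda>W. {y \<in> topspace Y. g y \<in> W}) ` \<W>"
  have "\<exists>W\<in>\<W>. g y \<in> W" if "y \<in> topspace Y" for y
  proof -
    have "g y \<in> topspace X"
      using that continuous_map_image_subset_topspace[OF g] by blast
    then show ?thesis
      using \<W>(2) by (metis UnionE cover_of_def open_cover_of_def)
  qed
  then have cov: "\<Union>?W = topspace Y"
    by auto
  show "\<exists>\<W>. finite \<W> \<and> open_cover_of Y \<W> \<and> refinement_of (topspace Y) \<U> \<W> \<and>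
          collection_dim_le \<W> n"
  proof (intro exI conjI)
    show "finite ?W"
      using \<W>(1) by simp
    show "open_cover_of Y ?W"
      using cov \<W>(2) openin_continuous_map_preimage[OF g]
      by (auto simp: open_cover_of_def cover_of_def)
    have "\<exists>U\<in>\<U>. {y \<in> topspace Y. g y \<in> W} \<subseteq> U" if W: "W \<in> \<W>" for W
    proof -
      obtain A where "A \<in> ?U" "W \<subseteq> A"
        using \<W>(3) W unfolding refinement_of_def by meson
      then obtain U where U: "U \<in> \<U>" "W \<subseteq> {x \<in> topspace X. f x \<in> U}"
        by auto
      have "y \<in> U" if "y \<in> topspace Y" "g y \<in> W" for y
        using U(2) fg[OF that(1)] that(2) by auto
      then show ?thesis
        using U(1) by auto
    qed
    then show "refinement_of (topspace Y) \<U> ?W"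
      unfolding refinement_of_def cover_of_def using cov by auto
    show "collection_dim_le ?W n"
      unfolding collection_dim_le_def
    proof
      fix y
      have sub: "{V \<in> ?W. y \<in> V} \<subseteq> (\<lambda>W. {y \<in> topspace Y. g y \<in> W}) ` {W \<in> \<W>. g y \<in> W}"
        by blast
      have fin: "finite {W \<in> \<W>. g y \<in> W}" and le: "card {W \<in> \<W>. g y \<in> W} \<le> n + 1"
        using \<W>(4) unfolding collection_dim_le_def by auto
      show "finite {V \<in> ?W. y \<in> V} \<and> card {V \<in> ?W. y \<in> V} \<le> n + 1"
        using sub fin le by (meson card_image_le card_mono finite_imageI finite_subset le_trans)
    qed
  qed
qed

lemma covering_dim_le_empty: "topspace X = {} \<Longrightarrow> covering_dim_le X n"
  unfolding covering_dim_le_def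
  by (auto intro!: exI[of _ "{}"] simp: open_cover_of_def cover_of_def refinement_of_def
      collection_dim_le_def)

text \<open>Each member of a refinement is assigned to one \<open>V i\<close> containing it, and the
  members with the same index are united. Distinct indices at a point come from distinct members
  there, so the order does not grow.\<close>

lemma covering_dim_le_shrinking:
  fixes V :: "'i \<Rightarrow> 'a set"
  assumes dim: "covering_dim_le X n"
    and fin: "finite {i. V i \<noteq> {}}" and op: "\<And>i. openin X (V i)" and cov: "topspace X \<subseteq> (\<Union>i. V i)"
  obtains W where "\<And>i. openin X (W i)" "\<And>i. W i \<subseteq> V i" "topspace X \<subseteq> (\<Union>i. W i)"
    "\<And>x. order_at_le W n x"
proof -
  let ?S = "{i. V i \<noteq> {}}"
  have "open_cover_of X (V ` ?S)"
  proof -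
    have "(\<Union>i. V i) \<subseteq> topspace X"
      using op openin_subset by blast
    moreover have "\<Union>(V ` ?S) = (\<Union>i. V i)"
      by blast
    ultimately show ?thesis
      using cov op by (auto simp: open_cover_of_def cover_of_def)
  qed
  then obtain \<W> where \<W>: "finite \<W>" "open_cover_of X \<W>"
      "refinement_of (topspace X) (V ` ?S) \<W>" "collection_dim_le \<W> n"
    using dim fin unfolding covering_dim_le_def by (meson finite_imageI)
  have "\<forall>A\<in>\<W>. \<exists>i. A \<subseteq> V i"
    using \<W>(3) unfolding refinement_of_def by blast
  then obtain c where c: "\<And>A. A \<in> \<W> \<Longrightarrow> A \<subseteq> V (c A)"
    by metis
  define W where "W = (\<lambda>i. \<Union>{A \<in> \<W>. c A = i})"
  show thesis
  proof
    show "openin X (W i)" for i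
      using \<W>(2) unfolding W_def open_cover_of_def by blast
    show "W i \<subseteq> V i" for i
      using c unfolding W_def by blast
    show "topspace X \<subseteq> (\<Union>i. W i)"
      using \<W>(2) unfolding W_def open_cover_of_def cover_of_def by blast
    fix x
    have sub: "{i. x \<in> W i} \<subseteq> c ` {A \<in> \<W>. x \<in> A}"
      unfolding W_def by blast
    have fin: "finite {A \<in> \<W>. x \<in> A}" and le: "card {A \<in> \<W>. x \<in> A} \<le> n + 1"
      using \<W>(4) unfolding collection_dim_le_def by auto
    show "order_at_le W n x"
      unfolding order_at_le_def
      using sub fin le by (meson card_image_le card_mono finite_imageI finite_subset le_trans)
  qed
qed

text \<open>The dimension bound gives a shrinking \<open>W a\<close> on each piece separately, and
  \<open>B a - W a i\<close> is deleted from \<open>V i\<close>. Local finiteness makes the deleted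
  set closed, and disjointness makes the new family agree with \<open>W a\<close> on
  \<open>B a\<close>. That nothing is lost off the pieces is recorded because it makes infinite
  iteration converge later.\<close>

lemma reduce_order_on_discrete:
  fixes V :: "'i \<Rightarrow> 'a set" and B :: "'j \<Rightarrow> 'a set"
  assumes op: "\<And>i. openin X (V i)" and cov: "topspace X \<subseteq> (\<Union>i. V i)"
    and clo: "\<And>a. closedin X (B a)" and lf: "locally_finite_family X B"
    and disj: "\<And>a b. a \<noteq> b \<Longrightarrow> B a \<inter> B b = {}"
    and fin: "\<And>a. finite {i. V i \<inter> B a \<noteq> {}}"
    and dim: "\<And>a. covering_dim_le (subtopology X (B a)) n"
  obtains V' where "\<And>i. openin X (V' i)" "\<And>i. V' i \<subseteq> V i" "topspace X \<subseteq> (\<Union>i. V' i)"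
    "\<And>i. V i - (\<Union>a. B a) \<subseteq> V' i" "\<And>x a. x \<in> B a \<Longrightarrow> order_at_le V' n x"
proof -
  have "\<forall>a. \<exists>W. (\<forall>i. openin (subtopology X (B a)) (W i)) \<and> (\<forall>i. W i \<subseteq> V i) \<and>
          B a \<subseteq> (\<Union>i. W i) \<and> (\<forall>x. order_at_le W n x)"
  proof
    fix a
    have "B a \<subseteq> topspace X"
      using clo closedin_subset by blast
    with cov have "topspace (subtopology X (B a)) \<subseteq> (\<Union>i. V i \<inter> B a)"
      by auto
    then obtain W where "\<And>i. openin (subtopology X (B a)) (W i)" "\<And>i. W i \<subseteq> V i \<inter> B a"
       "topspace (subtopology X (B a)) \<subseteq> (\<Union>i. W i)" "\<And>x. order_at_le W n x"
      using covering_dim_le_shrinking[OF dim[of a], of "\<lambda>i. V i \<inter> B a"] fin[of a] op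
      by (metis openin_subtopology_Int)
    then show "\<exists>W. (\<forall>i. openin (subtopology X (B a)) (W i)) \<and> (\<forall>i. W i \<subseteq> V i) \<and>
          B a \<subseteq> (\<Union>i. W i) \<and> (\<forall>x. order_at_le W n x)"
      using \<open>B a \<subseteq> topspace X\<close> by (intro exI[of _ W]) (auto simp: Int_absorb1)
  qed
  then obtain W where W: "\<And>a i. openin (subtopology X (B a)) (W a i)" "\<And>a i. W a i \<subseteq> V i"
      "\<And>a. B a \<subseteq> (\<Union>i. W a i)" "\<And>a x. order_at_le (W a) n x"
    by metis
  define V' where "V' = (\<lambda>i. V i - (\<Union>a. B a - W a i))"
  show thesis
  proof
    fix i
    have "closedin X (B a - W a i)" for a
    proof -
      have "closedin (subtopology X (B a)) (topspace (subtopology X (B a)) - W a i)"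
        using W(1) by blast
      then have "closedin (subtopology X (B a)) (B a - W a i)"
        using clo closedin_subset by (metis topspace_subtopology_subset)
      then show ?thesis
        using clo closedin_trans_full by blast
    qed
    moreover have "locally_finite_family X (\<lambda>a. B a - W a i)"
      using lf by (rule locally_finite_family_mono) blast
    ultimately have "closedin X (\<Union>a. B a - W a i)"
      by (intro closedin_UN_locally_finite_family)
    then show "openin X (V' i)"
      unfolding V'_def using op by blast
  next
    show "V' i \<subseteq> V i" for i
      unfolding V'_def by blast
    show "V i - (\<Union>a. B a) \<subseteq> V' i" for i
      unfolding V'_def by blast
    have on_B: "x \<in> V' i \<longleftrightarrow> x \<in> W a i" if "x \<in> B a" for x a i
    proof -
      have "x \<notin> B b" if "b \<noteq> a" for b
        using that \<open>x \<in> B a\<close> disj by blast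
      then have "x \<in> (\<Union>b. B b - W b i) \<longleftrightarrow> x \<notin> W a i"
        using \<open>x \<in> B a\<close> by (auto, metis)
      then show ?thesis
        unfolding V'_def using W(2) by auto
    qed
    show "order_at_le V' n x" if "x \<in> B a" for x a
      using W(4)[of a x] by (rule order_at_le_mono) (simp add: on_B[OF that])
    show "topspace X \<subseteq> (\<Union>i. V' i)"
    proof
      fix x assume x: "x \<in> topspace X"
      show "x \<in> (\<Union>i. V' i)"
      proof (cases "\<exists>a. x \<in> B a")
        case True
        then obtain a where a: "x \<in> B a"
          by blast
        then obtain i where "x \<in> W a i"
          using W(3) by blast
        then show ?thesis
          using on_B[OF a] by blast
      next
        case False
        then show ?thesis
          unfolding V'_def using cov x by blast
      qed
    qed
  qed
qed

section \<open>Locally finite shrinkings in metric spaces\<close>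

text \<open>The well-ordering theorem, reduced to the properties that the choice of a least index
  requires.\<close>

lemma exists_least_index:
  obtains r :: "'i rel" where "antisym r" "total r" "\<And>A :: 'i set. A \<noteq> {} \<Longrightarrow> \<exists>a\<in>A. \<forall>b\<in>A. (a, b) \<in> r"
proof -
  obtain r :: "'i rel" where r: "Well_order r" and F: "Field r = UNIV"
    using well_ordering by metis
  interpret wo_rel r
    using r by (simp add: wo_rel_def)
  show thesis
  proof
    show "antisym r" "total r"
      using r F by (auto simp: well_order_on_def linear_order_on_def partial_order_on_def)
    show "\<exists>a\<in>A. \<forall>b\<in>A. (a, b) \<in> r" if "A \<noteq> {}" for A
      using minim_in[of A] minim_least[of A] that F by blast
  qed
qed

context Metric_space
begin

text \<open>M. E. Rudin's construction from her proof that metric spaces are paracompact: at stage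
  \<open>m\<close> one takes the balls of radius \<open>1/2^m\<close> around the points that are not yet covered, each sorted
  under the least index \<open>i\<close> for which \<open>U i\<close> contains the centre, provided that the concentric ball
  of three times the radius lies in \<open>U i\<close>.\<close>

lemma sigma_discrete_shrinking:
  fixes U :: "'i \<Rightarrow> 'a set"
  assumes op: "\<And>i. openin mtopology (U i)" and cov: "M \<subseteq> (\<Union>i. U i)"
  obtains D K :: "'i \<Rightarrow> nat \<Rightarrow> 'a set"
  where "\<And>i m. openin mtopology (D i m)" "\<And>i m. closedin mtopology (K i m)"
    "\<And>i m. D i m \<subseteq> K i m" "\<And>i m. K i m \<subseteq> U i"
    "\<And>i j m. i \<noteq> j \<Longrightarrow> K i m \<inter> K j m = {}" "M \<subseteq> (\<Union>i m. D i m)"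
    "locally_finite_family mtopology (\<lambda>(i, m). K i m)"
proof -
  obtain r :: "'i rel" where r: "antisym r" "total r"
      "\<And>A. A \<noteq> {} \<Longrightarrow> \<exists>a\<in>A. \<forall>b\<in>A. (a, b) \<in> r"
    using exists_least_index by metis
  have "\<forall>x\<in>M. \<exists>i. x \<in> U i \<and> (\<forall>j. x \<in> U j \<longrightarrow> (i, j) \<in> r)"
  proof
    fix x assume "x \<in> M"
    then have "{i. x \<in> U i} \<noteq> {}"
      using cov by auto
    from r(3)[OF this] show "\<exists>i. x \<in> U i \<and> (\<forall>j. x \<in> U j \<longrightarrow> (i, j) \<in> r)"
      by auto
  qed
  then obtain \<iota> where \<iota>: "\<And>x. x \<in> M \<Longrightarrow> x \<in> U (\<iota> x)"
      "\<And>x j. x \<in> M \<Longrightarrow> x \<in> U j \<Longrightarrow> (\<iota> x, j) \<in> r"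
    by metis
  \<comment> \<open>\<open>cov m\<close> is what the stages before \<open>m\<close> have covered;
    the centres of stage \<open>m\<close> are taken outside it.\<close>
  define cov where "cov = rec_nat {} (\<lambda>m c. c \<union>
     (\<Union>x\<in>{x \<in> M - c. mball x (3 / 2 ^ m) \<subseteq> U (\<iota> x)}. mball x (1 / 2 ^ m)))"
  have cov_Suc: "cov (Suc m) = cov m \<union>
     (\<Union>x\<in>{x \<in> M - cov m. mball x (3 / 2 ^ m) \<subseteq> U (\<iota> x)}. mball x (1 / 2 ^ m))" for m
    by (simp add: cov_def)
  define D where "D = (\<lambda>i m.
     \<Union>x\<in>{x \<in> M - cov m. \<iota> x = i \<and> mball x (3 / 2 ^ m) \<subseteq> U i}. mball x (1 / 2 ^ m))"
  define K where "K = (\<lambda>i m. mtopology closure_of (D i m))"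
  have D_cov: "D i m \<subseteq> cov (Suc m)" for i m
    unfolding D_def cov_Suc by blast
  have cov_mono: "cov m \<subseteq> cov k" if "m \<le> k" for m k
    using that by (induction k rule: dec_induct) (auto simp: cov_Suc)
  have cov_D: "cov m \<subseteq> (\<Union>i m. D i m)" for m
  proof (induction m)
    case 0
    show ?case by (simp add: cov_def)
  next
    case (Suc m)
    show ?case
    proof
      fix y assume "y \<in> cov (Suc m)"
      then consider "y \<in> cov m" | x where "x \<in> M - cov m" "mball x (3 / 2 ^ m) \<subseteq> U (\<iota> x)" "y \<in> mball x (1 / 2 ^ m)"
        unfolding cov_Suc by auto
      then show "y \<in> (\<Union>i m. D i m)"
      proof cases
        case 1
        then show ?thesis
          using Suc by (rule rev_subsetD)
      next
        case (2 x)
        then have "y \<in> D (\<iota> x) m"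
          unfolding D_def by auto
        then show ?thesis
          by auto
      qed
    qed
  qed
  have D_centre: "\<exists>a\<in>M - cov m. \<iota> a = i \<and> mball a (3 / 2 ^ m) \<subseteq> U i \<and> y \<in> M \<and> d a y < 1 / 2 ^ m"
    if "y \<in> D i m" for y i m
    using that unfolding D_def by auto
  have openD: "openin mtopology (D i m)" for i m
    unfolding D_def by blast
  have D_M: "D i m \<subseteq> M" for i m
    using openD openin_subset by fastforce
  \<comment> \<open>The factor 3 pays off here. The centre \<open>b\<close> has least index
    \<open>j\<close>, which comes after \<open>i\<close>, so it lies outside \<open>U i\<close> and
    hence at least three radii from \<open>a\<close>; the distances of \<open>y\<close> and
    \<open>z\<close> from their centres use up less than two, and one radius is left.\<close>
  have sep0: "1 / 2 ^ m \<le> d y z"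
    if y: "y \<in> D i m" and z: "z \<in> D j m" and ij: "(i, j) \<in> r" "i \<noteq> j" for y z i j m
  proof -
    obtain a where a: "a \<in> M" "\<iota> a = i" "mball a (3 / 2 ^ m) \<subseteq> U i" "y \<in> M" "d a y < 1 / 2 ^ m"
      using D_centre[OF y] by blast
    obtain b where b: "b \<in> M" "\<iota> b = j" "z \<in> M" "d b z < 1 / 2 ^ m"
      using D_centre[OF z] by blast
    have "b \<notin> U i"
      using \<iota>(2)[of b i] b ij r(1) by (auto simp: antisym_def)
    then have "3 / 2 ^ m \<le> d a b"
      using a(3) a(1) b(1) by (auto simp: subset_iff not_less[symmetric])
    moreover have "d a b \<le> d a y + d y z + d b z"
      using triangle[OF a(1,4) b(1)] triangle[OF a(4) b(3) b(1)] commute[of b z] by linarith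
    moreover have "3 / 2 ^ m = 1 / 2 ^ m + 1 / 2 ^ m + 1 / (2::real) ^ m"
      by simp
    ultimately show ?thesis
      using a(5) b(4) by linarith
  qed
  have sep: "1 / 2 ^ m \<le> d y z" if "y \<in> D i m" "z \<in> D j m" "i \<noteq> j" for y z i j m
  proof (cases "(i, j) \<in> r")
    case True
    then show ?thesis
      using sep0 that by blast
  next
    case False
    then have "(j, i) \<in> r"
      using r(2) that(3) by (auto simp: total_on_def)
    then show ?thesis
      using sep0[OF that(2,1)] that(3) commute by metis
  qed
  have near: "\<exists>y'\<in>D i m. y' \<in> M \<and> d y y' < e" if "y \<in> K i m" "e > 0" for y i m e
    using that unfolding K_def metric_closure_of by auto
  have K_M: "K i m \<subseteq> M" for i m
    unfolding K_def metric_closure_of by auto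
  show thesis
  proof
    show "openin mtopology (D i m)" for i m
      by (rule openD)
    show "closedin mtopology (K i m)" for i m
      unfolding K_def by simp
    show "D i m \<subseteq> K i m" for i m
      unfolding K_def using D_M by (intro closure_of_subset) simp
    show "K i m \<subseteq> U i" for i m
    proof
      fix y assume y: "y \<in> K i m"
      then obtain y' where y': "y' \<in> D i m" "y' \<in> M" "d y y' < 1 / 2 ^ m"
        using near[OF y, of "1 / 2 ^ m"] by auto
      obtain a where a: "a \<in> M" "mball a (3 / 2 ^ m) \<subseteq> U i" "d a y' < 1 / 2 ^ m"
        using D_centre[OF y'(1)] by blast
      have yM: "y \<in> M"
        using y K_M by blast
      have "d a y < 1 / 2 ^ m + 1 / 2 ^ m"
        using triangle[OF a(1) y'(2) yM] a(3) y'(3) commute[of y y'] by linarith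
      also have "\<dots> \<le> 3 / 2 ^ m"
        by (simp add: field_simps)
      finally show "y \<in> U i"
        using a yM by auto
    qed
    show "K i m \<inter> K j m = {}" if "i \<noteq> j" for i j m
    proof (rule ccontr)
      assume "K i m \<inter> K j m \<noteq> {}"
      then obtain y where y: "y \<in> K i m" "y \<in> K j m"
        by blast
      \<comment> \<open>Half of the gap \<open>1 / 2 ^ m\<close> is granted to each of the two
        approximations of the common closure point.\<close>
      have e: "(0::real) < 1 / 2 ^ Suc m"
        by simp
      obtain u where u: "u \<in> D i m" "u \<in> M" "d y u < 1 / 2 ^ Suc m"
        using near[OF y(1) e] by blast
      obtain v where v: "v \<in> D j m" "v \<in> M" "d y v < 1 / 2 ^ Suc m"
        using near[OF y(2) e] by blast
      have "d u v \<le> d y u + d y v"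
        using triangle[of u y v] u v y K_M commute[of u y] by auto
      moreover have "1 / 2 ^ Suc m + 1 / 2 ^ Suc m = 1 / (2::real) ^ m"
        by simp
      ultimately show False
        using sep[OF u(1) v(1) that] u(3) v(3) by linarith
    qed
    show covD: "M \<subseteq> (\<Union>i m. D i m)"
    proof
      fix x assume x: "x \<in> M"
      \<comment> \<open>Once \<open>3 / 2 ^ m\<close> is below \<open>e\<close>, the point
        \<open>x\<close> is either covered before stage \<open>m\<close> or is itself a centre of
        stage \<open>m\<close>.\<close>
      obtain e where e: "e > 0" "mball x e \<subseteq> U (\<iota> x)"
        using op[of "\<iota> x"] \<iota>(1)[OF x] unfolding openin_mtopology by blast
      obtain m where m: "1 / 2 ^ m < e / 3"
        using real_arch_pow_inv[of "e / 3" "1 / 2"] e(1) by (auto simp: power_one_over)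
      then have "mball x (3 / 2 ^ m) \<subseteq> U (\<iota> x)"
        using e(2) mball_subset_concentric[of "3 / 2 ^ m" e x] by auto
      then have "x \<in> cov m \<or> x \<in> D (\<iota> x) m"
        unfolding D_def using x by auto
      then show "x \<in> (\<Union>i m. D i m)"
        using cov_D by blast
    qed
    show "locally_finite_family mtopology (\<lambda>(i, m). K i m)"
      unfolding locally_finite_family_def
    proof
      fix x assume "x \<in> topspace mtopology"
      then have x: "x \<in> M"
        by simp
      then obtain i0 k where x0: "x \<in> D i0 k"
        using covD by blast
      then obtain e where e: "e > 0" "mball x e \<subseteq> D i0 k"
        using openD unfolding openin_mtopology by blast
      obtain j where j: "1 / 2 ^ j < e"
        using real_arch_pow_inv[of e "1 / 2"] e(1) by (auto simp: power_one_over)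
      \<comment> \<open>From stage \<open>p > k\<close> on, centres avoid \<open>D i0 k\<close> and
        so the \<open>e\<close>-ball of \<open>x\<close>; since \<open>p > j\<close>, twice
        \<open>1 / 2 ^ p\<close> is below \<open>e\<close>, and the balls of these stages miss
        \<open>?N\<close>. At a stage \<open>m < p\<close> the gap \<open>1 / 2 ^ m\<close> is at
        least the diameter bound \<open>2 / 2 ^ p\<close> of \<open>?N\<close>, which thus meets at
        most one index.\<close>
      define p where "p = j + k + 2"
      let ?N = "mball x (1 / 2 ^ p)"
      have far: "D i m \<inter> ?N = {}" if m: "p \<le> m" for i m
      proof (rule ccontr)
        assume "D i m \<inter> ?N \<noteq> {}"
        then obtain y where y: "y \<in> D i m" "y \<in> M" "d x y < 1 / 2 ^ p"
          by auto
        obtain a where a: "a \<in> M" "a \<notin> cov m" "d a y < 1 / 2 ^ m"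
          using D_centre[OF y(1)] by blast
        have "D i0 k \<subseteq> cov m"
          using D_cov[of i0 k] cov_mono[of "Suc k" m] m p_def by force
        then have "a \<notin> mball x e"
          using a(2) e(2) by blast
        then have "e \<le> d x a"
          using a(1) x by auto
        moreover have "d x a \<le> d x y + d a y"
          using triangle[OF x y(2) a(1)] commute[of a y] by linarith
        moreover have "1 / 2 ^ m \<le> 1 / (2::real) ^ p"
          using m by (simp add: field_simps)
        moreover have "1 / 2 ^ p \<le> 1 / (2::real) ^ Suc j"
          unfolding p_def by (intro divide_left_mono power_increasing) auto
        moreover have "1 / 2 ^ Suc j + 1 / 2 ^ Suc j = 1 / (2::real) ^ j"
          by simp
        ultimately show False
          using j y(3) a(3) by linarith
      qed
      have one: "finite {i. D i m \<inter> ?N \<noteq> {}}" if m: "m < p" for m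
      proof -
        have "i = i'" if h: "D i m \<inter> ?N \<noteq> {}" "D i' m \<inter> ?N \<noteq> {}" for i i'
        proof (rule ccontr)
          assume ne: "i \<noteq> i'"
          obtain y where y: "y \<in> D i m" "y \<in> M" "d x y < 1 / 2 ^ p"
            using h(1) by auto
          obtain z where z: "z \<in> D i' m" "z \<in> M" "d x z < 1 / 2 ^ p"
            using h(2) by auto
          have "d y z \<le> d x y + d x z"
            using triangle[OF y(2) x z(2)] commute[of x y] by linarith
          moreover have "1 / 2 ^ p \<le> 1 / (2::real) ^ Suc m"
            using m by (intro divide_left_mono power_increasing) auto
          moreover have "1 / 2 ^ Suc m + 1 / 2 ^ Suc m = 1 / (2::real) ^ m"
            by simp
          ultimately show False
            using sep[OF y(1) z(1) ne] y(3) z(3) by linarith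
        qed
        then have "\<exists>i. {i. D i m \<inter> ?N \<noteq> {}} \<subseteq> {i}"
          by blast
        then show ?thesis
          by (meson finite.emptyI finite.insertI finite_subset)
      qed
      have K_N: "K i m \<inter> ?N \<noteq> {} \<longleftrightarrow> D i m \<inter> ?N \<noteq> {}" for i m
        unfolding K_def using openin_Int_closure_of_eq_empty[of mtopology ?N "D i m"]
        by (simp add: Int_commute)
      have "{q. (case q of (i, m) \<Rightarrow> K i m) \<inter> ?N \<noteq> {}}
          \<subseteq> (\<Union>m\<in>{..<p}. (\<lambda>i. (i, m)) ` {i. D i m \<inter> ?N \<noteq> {}})"
      proof
        fix q assume q: "q \<in> {q. (case q of (i, m) \<Rightarrow> K i m) \<inter> ?N \<noteq> {}}"
        obtain i m where im: "q = (i, m)"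
          by (cases q)
        have "D i m \<inter> ?N \<noteq> {}"
          using q K_N unfolding im by simp
        moreover from this have "m < p"
          using far by (meson not_less)
        ultimately show "q \<in> (\<Union>m\<in>{..<p}. (\<lambda>i. (i, m)) ` {i. D i m \<inter> ?N \<noteq> {}})"
          unfolding im by blast
      qed
      moreover have "finite (\<Union>m\<in>{..<p}. (\<lambda>i. (i, m)) ` {i. D i m \<inter> ?N \<noteq> {}})"
        using one by blast
      ultimately have "finite {q. (case q of (i, m) \<Rightarrow> K i m) \<inter> ?N \<noteq> {}}"
        by (rule finite_subset)
      then show "\<exists>N. openin mtopology N \<and> x \<in> N \<and> finite {q. (case q of (i, m) \<Rightarrow> K i m) \<inter> N \<noteq> {}}"
        using x by (intro exI[of _ ?N]) auto
    qed
  qed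
qed

end

section \<open>Locally finite shrinkings and reduction of the order on closed sets\<close>

context Metric_space
begin

text \<open>The levels of the \<open>\<sigma>\<close>-discrete shrinking are united for each index;
  a neighbourhood meeting finitely many pairs \<open>(i, m)\<close> meets finitely many
  \<open>i\<close>. The closed layer \<open>K\<close> between \<open>W\<close> and \<open>U\<close>
  is what \<open>openin_order_at_le\<close> requires.\<close>

lemma locally_finite_shrinking:
  fixes U :: "'i \<Rightarrow> 'a set"
  assumes "\<And>i. openin mtopology (U i)" "M \<subseteq> (\<Union>i. U i)"
  obtains W K where "\<And>i. openin mtopology (W i)" "\<And>i. closedin mtopology (K i)"
    "\<And>i. W i \<subseteq> K i" "\<And>i. K i \<subseteq> U i" "M \<subseteq> (\<Union>i. W i)" "locally_finite_family mtopology K"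
proof -
  obtain D K :: "'i \<Rightarrow> nat \<Rightarrow> 'a set" where
      openD: "\<And>i m. openin mtopology (D i m)" and closedK: "\<And>i m. closedin mtopology (K i m)"
    and DK: "\<And>i m. D i m \<subseteq> K i m" and KU: "\<And>i m. K i m \<subseteq> U i"
    and "\<And>i j m. i \<noteq> j \<Longrightarrow> K i m \<inter> K j m = {}" and cov: "M \<subseteq> (\<Union>i m. D i m)"
    and lf: "locally_finite_family mtopology (\<lambda>(i, m). K i m)"
    using sigma_discrete_shrinking[of U, OF assms] by metis
  show thesis
  proof
    show "openin mtopology (\<Union>m. D i m)" for i
      using openD by blast
    show "closedin mtopology (\<Union>m. K i m)" for i
    proof (rule closedin_UN_locally_finite_family)
      show "locally_finite_family mtopology (K i)"
        using locally_finite_family_reindex[OF lf, of "Pair i"] by (simp add: inj_on_def)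
    qed (rule closedK)
    show "(\<Union>m. D i m) \<subseteq> (\<Union>m. K i m)" for i
      using DK by (rule UN_mono[OF subset_refl])
    show "(\<Union>m. K i m) \<subseteq> U i" for i
      using KU by (rule UN_least)
    show "M \<subseteq> (\<Union>i m. D i m)"
      by (rule cov)
    show "locally_finite_family mtopology (\<lambda>i. \<Union>m. K i m)"
      unfolding locally_finite_family_def
    proof
      fix x assume "x \<in> topspace mtopology"
      then obtain N where N: "openin mtopology N" "x \<in> N"
          "finite {q. (case q of (i, m) \<Rightarrow> K i m) \<inter> N \<noteq> {}}"
        using lf unfolding locally_finite_family_def by metis
      have "{i. (\<Union>m. K i m) \<inter> N \<noteq> {}} \<subseteq> fst ` {q. (case q of (i, m) \<Rightarrow> K i m) \<inter> N \<noteq> {}}"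
        by force
      then show "\<exists>N. openin mtopology N \<and> x \<in> N \<and> finite {i. (\<Union>m. K i m) \<inter> N \<noteq> {}}"
        using N by (meson finite_imageI finite_subset)
    qed
  qed
qed

text \<open>The sets \<open>K x m \<inter> E\<close> are discrete for each fixed \<open>m\<close>, so the order can be reduced on one level
  \<open>m\<close> at a time; by local finiteness the decreasing sequence of covers obtained in this way is
  locally eventually constant, and its limit is an open cover.\<close>

lemma order_reduction_on_closed:
  fixes V :: "'i \<Rightarrow> 'a set"
  assumes op: "\<And>i. openin mtopology (V i)" and cov: "M \<subseteq> (\<Union>i. V i)"
    and lf: "locally_finite_family mtopology V" and E: "closedin mtopology E"
    and small: "\<And>x. x \<in> E \<Longrightarrow> \<exists>r>0. \<forall>B. closedin mtopology B \<longrightarrow> B \<subseteq> mball x r \<inter> E \<longrightarrow>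
                  covering_dim_le (subtopology mtopology B) n"
  obtains V' where "\<And>i. openin mtopology (V' i)" "\<And>i. V' i \<subseteq> V i" "M \<subseteq> (\<Union>i. V' i)"
    "\<And>x. x \<in> E \<Longrightarrow> order_at_le V' n x"
proof -
  have EM: "E \<subseteq> M"
    using E closedin_subset by force
  have "\<forall>x. \<exists>N. openin mtopology N \<and> (x \<in> M \<longrightarrow> x \<in> N) \<and> finite {i. V i \<inter> N \<noteq> {}} \<and>
     (\<forall>B. closedin mtopology B \<longrightarrow> B \<subseteq> N \<inter> E \<longrightarrow> covering_dim_le (subtopology mtopology B) n)"
  proof
    fix x
    show "\<exists>N. openin mtopology N \<and> (x \<in> M \<longrightarrow> x \<in> N) \<and> finite {i. V i \<inter> N \<noteq> {}} \<and>
     (\<forall>B. closedin mtopology B \<longrightarrow> B \<subseteq> N \<inter> E \<longrightarrow> covering_dim_le (subtopology mtopology B) n)"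
    proof (cases "x \<in> M")
      \<comment> \<open>The cover \<open>U\<close> is indexed by the whole type, so points outside
        \<open>M\<close> receive the empty set.\<close>
      case False
      have "covering_dim_le (subtopology mtopology {}) n"
        by (rule covering_dim_le_empty) simp
      then show ?thesis
        using False by (intro exI[of _ "{}"]) auto
    next
      case True
      then obtain N where N: "openin mtopology N" "x \<in> N" "finite {i. V i \<inter> N \<noteq> {}}"
        using lf unfolding locally_finite_family_def by auto
      have "\<exists>N'. openin mtopology N' \<and> x \<in> N' \<and>
        (\<forall>B. closedin mtopology B \<longrightarrow> B \<subseteq> N' \<inter> E \<longrightarrow> covering_dim_le (subtopology mtopology B) n)"
      proof (cases "x \<in> E")
        case True
        with small obtain r where r: "r > 0" "\<forall>B. closedin mtopology B \<longrightarrow> B \<subseteq> mball x r \<inter> E \<longrightarrow>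
                  covering_dim_le (subtopology mtopology B) n"
          by blast
        have "x \<in> mball x r"
          using r(1) \<open>x \<in> M\<close> by simp
        then show ?thesis
          using r(2) openin_mball by blast
      next
        case False
        \<comment> \<open>Away from \<open>E\<close> the complement of \<open>E\<close> serves, as
          the pieces inside it are empty.\<close>
        have "openin mtopology (M - E)"
          using E by (metis closedin_def topspace_mtopology)
        moreover have "covering_dim_le (subtopology mtopology B) n" if "B \<subseteq> (M - E) \<inter> E" for B
          by (rule covering_dim_le_empty) (use that in auto)
        ultimately show ?thesis
          using False \<open>x \<in> M\<close> by (intro exI[of _ "M - E"]) auto
      qed
      then obtain N' where N': "openin mtopology N'" "x \<in> N'" "\<And>B. closedin mtopology B \<Longrightarrow>
          B \<subseteq> N' \<inter> E \<Longrightarrow> covering_dim_le (subtopology mtopology B) n"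
        by metis
      have "{i. V i \<inter> (N \<inter> N') \<noteq> {}} \<subseteq> {i. V i \<inter> N \<noteq> {}}"
        by auto
      then have "finite {i. V i \<inter> (N \<inter> N') \<noteq> {}}"
        using N(3) finite_subset by metis
      then show ?thesis
        using N(1,2) N' by (intro exI[of _ "N \<inter> N'"]) auto
    qed
  qed
  then obtain U where U: "\<And>x. openin mtopology (U x)" "\<And>x. x \<in> M \<Longrightarrow> x \<in> U x"
      "\<And>x. finite {i. V i \<inter> U x \<noteq> {}}"
      "\<And>x B. closedin mtopology B \<Longrightarrow> B \<subseteq> U x \<inter> E \<Longrightarrow> covering_dim_le (subtopology mtopology B) n"
    by metis
  have "M \<subseteq> (\<Union>x. U x)"
    using U(2) by auto
  then obtain D K :: "'a \<Rightarrow> nat \<Rightarrow> 'a set" where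
      openD: "\<And>i m. openin mtopology (D i m)" and closedK: "\<And>i m. closedin mtopology (K i m)"
    and DK: "\<And>i m. D i m \<subseteq> K i m" and KU: "\<And>i m. K i m \<subseteq> U i"
    and disj: "\<And>i j m. i \<noteq> j \<Longrightarrow> K i m \<inter> K j m = {}" and covD: "M \<subseteq> (\<Union>i m. D i m)"
    and lfK: "locally_finite_family mtopology (\<lambda>(i, m). K i m)"
    using sigma_discrete_shrinking[of U, OF U(1)] by metis
  define B where "B = (\<lambda>x m. K x m \<inter> E)"
  have lfB: "locally_finite_family mtopology (\<lambda>x. B x m)" for m
  proof (rule locally_finite_family_mono)
    show "locally_finite_family mtopology (\<lambda>x. K x m)"
      using locally_finite_family_reindex[OF lfK, of "\<lambda>x. (x, m)"] by (simp add: inj_on_def)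
    show "B x m \<subseteq> K x m" for x
      by (simp add: B_def)
  qed
  have closedB: "closedin mtopology (B x m)" for x m
    unfolding B_def using closedK E by blast
  \<comment> \<open>Staying below \<open>V\<close> preserves the finiteness of the number of members
    on each \<open>U x\<close>, so the reduction can be repeated on the next level.\<close>
  have step: "\<exists>A'. (\<forall>i. openin mtopology (A' i)) \<and> M \<subseteq> (\<Union>i. A' i) \<and> (\<forall>i. A' i \<subseteq> V i) \<and>
      (\<forall>i. A' i \<subseteq> A i) \<and> (\<forall>i. A i - (\<Union>x. B x m) \<subseteq> A' i) \<and>
      (\<forall>x. \<forall>y\<in>B x m. order_at_le A' n y)"
    if A: "\<forall>i. openin mtopology (A i)" "M \<subseteq> (\<Union>i. A i)" "\<forall>i. A i \<subseteq> V i" for A m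
  proof -
    have fin: "finite {i. A i \<inter> B x m \<noteq> {}}" for x
    proof (rule finite_subset[OF _ U(3)[of x]])
      show "{i. A i \<inter> B x m \<noteq> {}} \<subseteq> {i. V i \<inter> U x \<noteq> {}}"
        using A(3) KU[of x m] unfolding B_def by fast
    qed
    have dim: "covering_dim_le (subtopology mtopology (B x m)) n" for x
      using closedB KU[of x m] by (intro U(4)[of _ x]) (auto simp: B_def)
    have disjB: "B x m \<inter> B y m = {}" if "x \<noteq> y" for x y
      using disj[OF that, of m] unfolding B_def by auto
    have covA: "topspace mtopology \<subseteq> (\<Union>i. A i)"
      using A(2) by simp
    show ?thesis
    proof (rule reduce_order_on_discrete[where B = "\<lambda>x. B x m",
            OF A(1)[rule_format] covA closedB lfB disjB fin dim])
      fix A' assume A': "\<And>i. openin mtopology (A' i)" "\<And>i. A' i \<subseteq> A i"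
        "topspace mtopology \<subseteq> (\<Union>i. A' i)" "\<And>i. A i - (\<Union>x. B x m) \<subseteq> A' i"
        "\<And>y x. y \<in> B x m \<Longrightarrow> order_at_le A' n y"
      have "A' i \<subseteq> V i" for i
        using A'(2)[of i] A(3) by auto
      then show ?thesis
        using A' by (intro exI[of _ A']) simp
    qed
  qed
  let ?P = "\<lambda>(m::nat) A. (\<forall>i. openin mtopology (A i)) \<and> M \<subseteq> (\<Union>i. A i) \<and> (\<forall>i. A i \<subseteq> V i)"
  let ?Q = "\<lambda>m A A'. (\<forall>i. A' i \<subseteq> A i) \<and> (\<forall>i. A i - (\<Union>x. B x m) \<subseteq> A' i) \<and>
      (\<forall>x. \<forall>y\<in>B x m. order_at_le A' n y)"
  have "\<exists>A. \<forall>m. ?P m (A m) \<and> ?Q m (A m) (A (Suc m))"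
  proof (rule dependent_nat_choice)
    show "\<exists>A. ?P 0 A"
      using op cov by (intro exI[of _ V]) auto
    fix A m assume "?P m A"
    then show "\<exists>A'. ?P (Suc m) A' \<and> ?Q m A A'"
      using step[of A m] by metis
  qed
  then obtain A where A: "\<And>m i. openin mtopology (A m i)" "\<And>m. M \<subseteq> (\<Union>i. A m i)"
      "\<And>m i. A m i \<subseteq> V i" and AS: "\<And>m i. A (Suc m) i \<subseteq> A m i"
      "\<And>m i. A m i - (\<Union>x. B x m) \<subseteq> A (Suc m) i"
      "\<And>m x y. y \<in> B x m \<Longrightarrow> order_at_le (A (Suc m)) n y"
    by metis
  define V' where "V' = (\<lambda>i. \<Inter>m. A m i)"
  have local: "\<exists>N m0. openin mtopology N \<and> x \<in> N \<and> (\<forall>i. V' i \<inter> N = A m0 i \<inter> N)" if x: "x \<in> M" for x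
  proof -
    obtain N where N: "openin mtopology N" "x \<in> N"
        "finite {q. (case q of (i, m) \<Rightarrow> K i m) \<inter> N \<noteq> {}}"
      using x lfK unfolding locally_finite_family_def topspace_mtopology by metis
    \<comment> \<open>Only finitely many pairs \<open>(i, m)\<close> meet \<open>N\<close>, so from
      level \<open>m0\<close> on no piece does and the covers no longer change on
      \<open>N\<close>.\<close>
    obtain m0 where m0: "\<forall>m\<in>snd ` {q. (case q of (i, m) \<Rightarrow> K i m) \<inter> N \<noteq> {}}. m < m0"
      using finite_imageI[OF N(3), of snd] unfolding finite_nat_set_iff_bounded by metis
    have m0: "m < m0" if "K a m \<inter> N \<noteq> {}" for a m
      by (rule bspec[OF m0]) (use that in force)
    have off: "B a m \<inter> N = {}" if "m0 \<le> m" for a m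
      using m0[of a m] that unfolding B_def by auto
    have ge: "A m0 i \<inter> N \<subseteq> A m i" for m i
    proof (cases "m0 \<le> m")
      case True
      then show ?thesis
      proof (induction m rule: dec_induct)
        case base
        show ?case by auto
      next
        case (step m)
        have "A m i \<inter> N \<subseteq> A (Suc m) i"
        proof -
          have "A m i - (\<Union>x. B x m) \<subseteq> A (Suc m) i"
            by (rule AS(2))
          then show ?thesis
            using off[OF step(1)] by auto
        qed
        then show ?case
          using step by auto
      qed
    next
      case False
      then have "m \<le> m0"
        by simp
      then have "A m0 i \<subseteq> A m i"
      proof (induction m0 rule: dec_induct)
        case (step k)
        then show ?case
          using AS(1)[of k i] by (meson subset_trans)
      qed auto
      then show ?thesis
        by auto
    qed
    have "V' i \<inter> N = A m0 i \<inter> N" for i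
      using ge unfolding V'_def by auto
    then show ?thesis
      using N by metis
  qed
  show thesis
  proof
    show "V' i \<subseteq> V i" for i
      using A(3)[of 0 i] unfolding V'_def by auto
    show "openin mtopology (V' i)" for i
    proof (subst openin_subopen, intro ballI)
      fix x assume x: "x \<in> V' i"
      then have "x \<in> M"
        using \<open>V' i \<subseteq> V i\<close> openin_subset[OF op] by auto
      then obtain N m0 where N: "openin mtopology N" "x \<in> N" "V' i \<inter> N = A m0 i \<inter> N"
        using local by metis
      have "openin mtopology (V' i \<inter> N)"
        using N A(1) by (metis openin_Int)
      then show "\<exists>T. openin mtopology T \<and> x \<in> T \<and> T \<subseteq> V' i"
        using x N(2) by (intro exI[of _ "V' i \<inter> N"]) auto
    qed
    show "M \<subseteq> (\<Union>i. V' i)"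
    proof
      fix x assume x: "x \<in> M"
      then obtain N m0 where N: "openin mtopology N" "x \<in> N" "\<And>i. V' i \<inter> N = A m0 i \<inter> N"
        using local by metis
      obtain i where "x \<in> A m0 i"
        using A(2)[of m0] x by auto
      then have "x \<in> V' i"
        using N(2) N(3)[of i] by auto
      then show "x \<in> (\<Union>i. V' i)"
        by auto
    qed
    show "order_at_le V' n x" if x: "x \<in> E" for x
    proof -
      \<comment> \<open>The bound at \<open>x\<close> is reached right after level \<open>m\<close>;
        later shrinking and the limit only remove sets.\<close>
      obtain a m where "x \<in> D a m"
        using x EM covD by auto
      then have "x \<in> B a m"
        using DK x unfolding B_def by auto
      from AS(3)[OF this] show ?thesis
        by (rule order_at_le_mono) (auto simp: V'_def)
    qed
  qed
qed

text \<open>Passing to a locally finite closed shrinking \<open>K\<close> spreads the bound on the order from \<open>C k\<close> to an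
  open neighbourhood \<open>G\<close>, and what is left of \<open>C (Suc k)\<close> is closed and lies in the stratum.\<close>

lemma open_shrinking_of_filtration:
  fixes U :: "'i \<Rightarrow> 'a set" and C :: "nat \<Rightarrow> 'a set"
  assumes op: "\<And>i. openin mtopology (U i)" and cov: "M \<subseteq> (\<Union>i. U i)"
    and C0: "C 0 = {}" and closedC: "\<And>k. closedin mtopology (C k)"
    and small: "\<And>k x. x \<in> C (Suc k) - C k \<Longrightarrow> \<exists>r>0. \<forall>B. closedin mtopology B \<longrightarrow>
                  B \<subseteq> mball x r \<inter> C (Suc k) \<longrightarrow> covering_dim_le (subtopology mtopology B) n"
  shows "\<exists>V. (\<forall>i. openin mtopology (V i)) \<and> (\<forall>i. V i \<subseteq> U i) \<and> M \<subseteq> (\<Union>i. V i) \<and>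
            (\<forall>x\<in>C k. order_at_le V n x)"
proof (induction k)
  case 0
  show ?case
    using op cov C0 by (intro exI[of _ U]) auto
next
  case (Suc k)
  then obtain V where V: "\<And>i. openin mtopology (V i)" "\<And>i. V i \<subseteq> U i" "M \<subseteq> (\<Union>i. V i)"
      "\<And>x. x \<in> C k \<Longrightarrow> order_at_le V n x"
    by metis
  obtain W K where WK: "\<And>i. openin mtopology (W i)" "\<And>i. closedin mtopology (K i)"
    "\<And>i. W i \<subseteq> K i" "\<And>i. K i \<subseteq> V i" "M \<subseteq> (\<Union>i. W i)" "locally_finite_family mtopology K"
    using locally_finite_shrinking[OF V(1,3)] by metis
  define G where "G = {x \<in> M. order_at_le K n x}"
  have "openin mtopology G"
    using openin_order_at_le[OF WK(6,2)] by (simp add: G_def)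
  then have E: "closedin mtopology (C (Suc k) - G)"
    using closedC by (simp add: closedin_diff)
  have CkG: "C k \<subseteq> G"
  proof
    fix x assume x: "x \<in> C k"
    have "order_at_le K n x"
      using V(4)[OF x] by (rule order_at_le_mono) (use WK(4) in auto)
    then show "x \<in> G"
      using x closedin_subset[OF closedC[of k]] by (auto simp: G_def)
  qed
  have smallE: "\<exists>r>0. \<forall>B. closedin mtopology B \<longrightarrow> B \<subseteq> mball x r \<inter> (C (Suc k) - G) \<longrightarrow>
                  covering_dim_le (subtopology mtopology B) n" if x: "x \<in> C (Suc k) - G" for x
  proof -
    have "x \<in> C (Suc k) - C k"
      using x CkG by auto
    from small[OF this] show ?thesis
      by (meson Diff_subset Int_mono subset_refl subset_trans)
  qed
  have lfW: "locally_finite_family mtopology W"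
    using WK(6,3) by (rule locally_finite_family_mono)
  obtain V' where V': "\<And>i. openin mtopology (V' i)" "\<And>i. V' i \<subseteq> W i" "M \<subseteq> (\<Union>i. V' i)"
    "\<And>x. x \<in> C (Suc k) - G \<Longrightarrow> order_at_le V' n x"
    using order_reduction_on_closed[OF WK(1,5) lfW E smallE] by metis
  \<comment> \<open>On \<open>G\<close> the bound is inherited from \<open>K\<close>, which contains
    \<open>V'\<close>; off \<open>G\<close> it comes from the reduction.\<close>
  have "order_at_le V' n x" if x: "x \<in> C (Suc k)" for x
  proof (cases "x \<in> G")
    case True
    then have "order_at_le K n x"
      by (simp add: G_def)
    then show ?thesis
      by (rule order_at_le_mono) (use V'(2) WK(3) in auto)
  next
    case False
    then show ?thesis
      using V'(4) x by simp
  qed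
  moreover have "V' i \<subseteq> U i" for i
    using V'(2)[of i] WK(3)[of i] WK(4)[of i] V(2)[of i] by simp
  ultimately show ?case
    using V'(1,3) by metis
qed

end

section \<open>The orbit space of a finite isometric action\<close>

locale finite_isometric_action = Metric_space Z d + group_action F Z \<phi>
  for Z :: "'a set" and d :: "'a \<Rightarrow> 'a \<Rightarrow> real" and F :: "('g, 'm) monoid_scheme" (structure)
    and \<phi> :: "'g \<Rightarrow> 'a \<Rightarrow> 'a" +
  assumes finite_carrier: "finite (carrier F)"
    and isometric: "\<And>g x y. \<lbrakk>g \<in> carrier F; x \<in> Z; y \<in> Z\<rbrakk> \<Longrightarrow> d (\<phi> g x) (\<phi> g y) = d x y"
begin

abbreviation orb :: "'a \<Rightarrow> 'a set" where
  "orb \<equiv> orbit F \<phi>"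

abbreviation Q :: "'a set set" where
  "Q \<equiv> orbits F Z \<phi>"

text \<open>The value \<open>0\<close> off the orbit space is there because \<^locale>\<open>Metric_space\<close> demands nonnegativity
  and symmetry for all arguments.\<close>

definition orbit_dist :: "'a set \<Rightarrow> 'a set \<Rightarrow> real" where
  "orbit_dist A B = (if A \<in> Q \<and> B \<in> Q then Min ((\<lambda>(a, b). d a b) ` (A \<times> B)) else 0)"

lemma is_group: "group F"
  using group_hom group_hom.axioms(1) by auto

lemma act_in: "g \<in> carrier F \<Longrightarrow> x \<in> Z \<Longrightarrow> \<phi> g x \<in> Z"
  using element_image by blast

lemma orb_subset: "x \<in> Z \<Longrightarrow> orb x \<subseteq> Z"
  using act_in unfolding orbit_def by auto

lemma act_in_orb: "g \<in> carrier F \<Longrightarrow> \<phi> g x \<in> orb x"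
  unfolding orbit_def by auto

lemma orb_eq:
  assumes "x \<in> Z" "y \<in> orb x"
  shows "orb y = orb x"
proof -
  have y: "y \<in> Z"
    using assms orb_subset by auto
  then have x: "x \<in> orb y"
    using orbit_sym assms by simp
  have "orb y \<subseteq> Z" "orb x \<subseteq> Z"
    using y assms(1) orb_subset by auto
  then show ?thesis
    using orbit_trans[OF assms(1) y _ assms(2)] orbit_trans[OF y assms(1) _ x] by blast
qed

lemma orb_act: "g \<in> carrier F \<Longrightarrow> x \<in> Z \<Longrightarrow> orb (\<phi> g x) = orb x"
  using orb_eq act_in_orb by simp

lemma finite_orb: "finite (orb x)"
proof -
  have "orb x = (\<lambda>g. \<phi> g x) ` carrier F"
    unfolding orbit_def by auto
  then show ?thesis
    using finite_carrier by simp
qed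

lemma in_orbits: "x \<in> Z \<Longrightarrow> orb x \<in> Q"
  unfolding orbits_def by auto

lemma orbitsE:
  assumes "A \<in> Q"
  obtains x where "x \<in> Z" "A = orb x"
  using assms unfolding orbits_def by auto

lemma orbit_dist_le:
  assumes "x \<in> Z" "y \<in> Z" "x' \<in> orb x" "y' \<in> orb y"
  shows "orbit_dist (orb x) (orb y) \<le> d x' y'"
proof -
  have "Min ((\<lambda>(a, b). d a b) ` (orb x \<times> orb y)) \<le> d x' y'"
    using assms(3,4) by (intro Min_le) (auto simp: finite_orb)
  then show ?thesis
    unfolding orbit_dist_def using assms(1,2) in_orbits by simp
qed

text \<open>A closest pair of points can be moved by a group element, at no change of distance,
  until its first point is the prescribed representative.\<close>

lemma orbit_dist_attained:
  assumes "x \<in> Z" "y \<in> Z"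
  obtains y' where "y' \<in> orb y" "y' \<in> Z" "orbit_dist (orb x) (orb y) = d x y'"
proof -
  interpret group F
    by (rule is_group)
  have "orbit_dist (orb x) (orb y) \<in> (\<lambda>(a, b). d a b) ` (orb x \<times> orb y)"
  proof -
    have "orb x \<noteq> {}" "orb y \<noteq> {}"
      using orbit_refl assms by auto
    then have "Min ((\<lambda>(a, b). d a b) ` (orb x \<times> orb y)) \<in> (\<lambda>(a, b). d a b) ` (orb x \<times> orb y)"
      by (intro Min_in) (auto simp: finite_orb)
    then show ?thesis
      unfolding orbit_dist_def using assms in_orbits by simp
  qed
  then obtain a b where ab: "a \<in> orb x" "b \<in> orb y" "orbit_dist (orb x) (orb y) = d a b"
    by auto
  obtain g where g: "g \<in> carrier F" "a = \<phi> g x"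
    using ab(1) unfolding orbit_def by auto
  have Z: "a \<in> Z" "b \<in> Z"
    using ab assms orb_subset by auto
  have ig: "inv g \<in> carrier F"
    using g(1) by simp
  have "\<phi> (inv g) a = x"
    using orbit_sym_aux[OF g(1) assms(1)] g(2) by simp
  then have "orbit_dist (orb x) (orb y) = d x (\<phi> (inv g) b)"
    using isometric[OF ig Z] ab(3) by simp
  moreover have "\<phi> (inv g) b \<in> orb y"
    using act_in_orb[OF ig, of b] orb_eq[OF assms(2) ab(2)] by simp
  ultimately show thesis
    using that orb_subset[OF assms(2)] by auto
qed

text \<open>In effect, balls of the orbit space are the images of balls of \<open>Z\<close> with the
  same radius.\<close>

lemma orbit_dist_less_iff:
  assumes "x \<in> Z" "B \<in> Q"
  shows "orbit_dist (orb x) B < r \<longleftrightarrow> (\<exists>y\<in>B. d x y < r)"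
proof -
  obtain y where y: "y \<in> Z" "B = orb y"
    using assms(2) by (rule orbitsE)
  show ?thesis
  proof
    assume "orbit_dist (orb x) B < r"
    then show "\<exists>y\<in>B. d x y < r"
      using orbit_dist_attained[OF assms(1) y(1)] y(2) by metis
  next
    assume "\<exists>y\<in>B. d x y < r"
    then obtain y' where "y' \<in> B" "d x y' < r"
      by auto
    then show "orbit_dist (orb x) B < r"
      using orbit_dist_le[OF assms(1) y(1) orbit_refl[OF assms(1)], of y'] y(2) by auto
  qed
qed

text \<open>For the triangle inequality, closest representatives are chained: from \<open>x\<close>
  to \<open>y'\<close>, and then from this same \<open>y'\<close> to \<open>z'\<close>.\<close>

lemma Metric_space_orbits: "Metric_space Q orbit_dist"
proof
  show "0 \<le> orbit_dist A B" for A B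
  proof (cases "A \<in> Q \<and> B \<in> Q")
    case True
    then obtain x y where "x \<in> Z" "y \<in> Z" "A = orb x" "B = orb y"
      using orbitsE by metis
    then show ?thesis
      using orbit_dist_attained[of x y] by (metis nonneg)
  next
    case False
    then show ?thesis
      unfolding orbit_dist_def by auto
  qed
  show "orbit_dist A B = orbit_dist B A" for A B
  proof -
    have "(\<lambda>(a, b). d a b) ` (A \<times> B) = (\<lambda>(a, b). d a b) ` (B \<times> A)"
      using commute by (force simp: image_iff)
    then show ?thesis
      unfolding orbit_dist_def by auto
  qed
  show "orbit_dist A B = 0 \<longleftrightarrow> A = B" if AB: "A \<in> Q" "B \<in> Q" for A B
  proof -
    obtain x y where xy: "x \<in> Z" "y \<in> Z" "A = orb x" "B = orb y"
      using AB orbitsE by metis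
    obtain y' where y': "y' \<in> orb y" "y' \<in> Z" "orbit_dist A B = d x y'"
      using orbit_dist_attained[OF xy(1,2)] xy(3,4) by metis
    show ?thesis
    proof
      assume "orbit_dist A B = 0"
      then have "x = y'"
        using y'(2,3) xy(1) zero by simp
      then show "A = B"
        using orb_eq[OF xy(2) y'(1)] xy(3,4) by simp
    next
      assume "A = B"
      then have "orbit_dist A B \<le> d x x"
        using orbit_dist_le[OF xy(1,2), of x x] orbit_refl[OF xy(1)] xy(3,4) by simp
      then show "orbit_dist A B = 0"
        using y'(2,3) xy(1) nonneg[of x y'] mdist_zero[of x] by simp
    qed
  qed
  show "orbit_dist A C \<le> orbit_dist A B + orbit_dist B C"
    if AB: "A \<in> Q" "B \<in> Q" "C \<in> Q" for A B C
  proof -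
    obtain x y z where xyz: "x \<in> Z" "y \<in> Z" "z \<in> Z" "A = orb x" "B = orb y" "C = orb z"
      using AB orbitsE by metis
    obtain y' where y': "y' \<in> orb y" "y' \<in> Z" "orbit_dist A B = d x y'"
      using orbit_dist_attained[OF xyz(1,2)] xyz(4,5) by metis
    have By': "B = orb y'"
      using orb_eq[OF xyz(2) y'(1)] xyz(5) by simp
    obtain z' where z': "z' \<in> orb z" "z' \<in> Z" "orbit_dist B C = d y' z'"
      using orbit_dist_attained[OF y'(2) xyz(3)] By' xyz(6) by metis
    have "orbit_dist A C \<le> d x z'"
      using orbit_dist_le[OF xyz(1,3) orbit_refl[OF xyz(1)] z'(1)] xyz(4,6) by simp
    also have "\<dots> \<le> d x y' + d y' z'"
      using triangle[OF xyz(1) y'(2) z'(2)] .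
    finally show ?thesis
      using y'(3) z'(3) by simp
  qed
qed

interpretation Q: Metric_space Q orbit_dist
  by (rule Metric_space_orbits)

lemma continuous_map_orb: "continuous_map mtopology Q.mtopology orb"
proof -
  have "openin mtopology {x \<in> Z. orb x \<in> V}" if V: "openin Q.mtopology V" for V
    unfolding openin_mtopology
  proof (intro conjI allI impI)
    fix x assume "x \<in> {x \<in> Z. orb x \<in> V}"
    then have x: "x \<in> Z" "orb x \<in> V"
      by auto
    then obtain r where r: "r > 0" "Q.mball (orb x) r \<subseteq> V"
      using V unfolding Q.openin_mtopology by metis
    have "orb y \<in> V" if y: "y \<in> Z" "d x y < r" for y
    proof -
      have "orbit_dist (orb x) (orb y) < r"
        using orbit_dist_less_iff[OF x(1) in_orbits[OF y(1)]] orbit_refl[OF y(1)] y(2) by auto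
      then show ?thesis
        using r(2) in_orbits x(1) y(1) by auto
    qed
    then show "\<exists>r>0. mball x r \<subseteq> {x \<in> Z. orb x \<in> V}"
      using r(1) by (intro exI[of _ r]) auto
  qed auto
  then show ?thesis
    using in_orbits by (auto simp: continuous_map_def)
qed

lemma openin_orb_image:
  assumes "openin mtopology U"
  shows "openin Q.mtopology (orb ` U)"
  unfolding Q.openin_mtopology
proof (intro conjI allI impI)
  have UZ: "U \<subseteq> Z"
    using openin_subset[OF assms] by simp
  then show "orb ` U \<subseteq> Q"
    using in_orbits by auto
  fix A assume "A \<in> orb ` U"
  then obtain x where x: "x \<in> U" "A = orb x"
    by auto
  obtain r where r: "r > 0" "mball x r \<subseteq> U"
    using assms x(1) unfolding openin_mtopology by metis
  have "B \<in> orb ` U" if B: "B \<in> Q" "orbit_dist A B < r" for B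
  proof -
    obtain y where y: "y \<in> B" "d x y < r"
      using orbit_dist_less_iff[of x B r] B x UZ by auto
    obtain z where z: "z \<in> Z" "B = orb z"
      using B(1) by (rule orbitsE)
    have "B = orb y" "y \<in> Z"
      using orb_eq[OF z(1)] orb_subset[OF z(1)] y(1) z(2) by auto
    moreover have "y \<in> U"
    proof -
      have "y \<in> mball x r"
        using x(1) UZ y(2) \<open>y \<in> Z\<close> by auto
      then show ?thesis
        using r(2) by blast
    qed
    ultimately show ?thesis
      by simp
  qed
  then show "\<exists>r>0. Q.mball A r \<subseteq> orb ` U"
    using r(1) by (intro exI[of _ r]) auto
qed

section \<open>Stabilizers and orbit sizes of nearby points\<close>

lemma displacement_gap:
  assumes "x \<in> Z"
  obtains e where "e > 0" "\<And>g. \<lbrakk>g \<in> carrier F; d (\<phi> g x) x < e\<rbrakk> \<Longrightarrow> \<phi> g x = x"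
proof -
  \<comment> \<open>The \<open>1\<close> keeps the set nonempty when every group element fixes
    \<open>x\<close>.\<close>
  let ?S = "insert 1 ((\<lambda>g. d (\<phi> g x) x) ` {g \<in> carrier F. \<phi> g x \<noteq> x})"
  have fin: "finite ?S"
    using finite_carrier by simp
  show thesis
  proof
    have "0 < s" if "s \<in> ?S" for s
      using that act_in assms mdist_pos_less by force
    then show "Min ?S > 0"
      using fin by (subst Min_gr_iff) auto
    show "\<phi> g x = x" if g: "g \<in> carrier F" "d (\<phi> g x) x < Min ?S" for g
    proof (rule ccontr)
      assume "\<phi> g x \<noteq> x"
      then have "Min ?S \<le> d (\<phi> g x) x"
        using g(1) by (intro Min_le[OF fin]) auto
      then show False
        using g(2) by simp
    qed
  qed
qed

text \<open>An isometry fixing \<open>y\<close> moves \<open>x\<close> by at most twice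
  \<open>d x y\<close>, whence the bound \<open>e / 2\<close>.\<close>

lemma stabilizer_subset_near:
  assumes x: "x \<in> Z" and y: "y \<in> Z"
    and e: "\<And>g. \<lbrakk>g \<in> carrier F; d (\<phi> g x) x < e\<rbrakk> \<Longrightarrow> \<phi> g x = x" and near: "d x y < e / 2"
  shows "stabilizer F \<phi> y \<subseteq> stabilizer F \<phi> x"
proof
  fix g assume "g \<in> stabilizer F \<phi> y"
  then have g: "g \<in> carrier F" "\<phi> g y = y"
    by (auto simp: stabilizer_def)
  have "d (\<phi> g x) x \<le> d (\<phi> g x) (\<phi> g y) + d y x"
    using triangle[of "\<phi> g x" y x] act_in g x y by simp
  also have "\<dots> = d x y + d x y"
    using isometric[OF g(1) x y] commute[of y x] by simp
  finally have "\<phi> g x = x"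
    using e[OF g(1)] near by simp
  then show "g \<in> stabilizer F \<phi> x"
    using g(1) by (simp add: stabilizer_def)
qed

text \<open>By the orbit-stabilizer theorem orbit size times stabilizer size is constant, so a
  smaller stabilizer means a larger orbit, and nested finite stabilizers of equal size
  coincide.\<close>

lemma card_orb_antimono:
  assumes "x \<in> Z" "y \<in> Z" "stabilizer F \<phi> y \<subseteq> stabilizer F \<phi> x"
  shows "card (orb x) \<le> card (orb y)"
    and "card (orb y) \<le> card (orb x) \<Longrightarrow> stabilizer F \<phi> y = stabilizer F \<phi> x"
proof -
  have fin: "finite (stabilizer F \<phi> z)" for z
    using finite_carrier by (simp add: stabilizer_def)
  have "\<one>\<^bsub>F\<^esub> \<in> stabilizer F \<phi> y"
    using stabilizer_one_closed assms(2) by simp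
  then have pos: "card (stabilizer F \<phi> y) > 0"
    using fin by (auto simp: card_gt_0_iff)
  have le: "card (stabilizer F \<phi> y) \<le> card (stabilizer F \<phi> x)"
    using assms(3) fin card_mono by blast
  have eq: "card (orb y) * card (stabilizer F \<phi> y) = card (orb x) * card (stabilizer F \<phi> x)"
    using orbit_stabilizer_theorem assms(1,2) by simp
  have opos: "card (orb x) > 0"
    using finite_orb orbit_refl[OF assms(1)] by (auto simp: card_gt_0_iff)
  show "card (orb x) \<le> card (orb y)"
  proof (rule ccontr)
    assume "\<not> ?thesis"
    then have "card (orb y) * card (stabilizer F \<phi> y) < card (orb x) * card (stabilizer F \<phi> y)"
      using pos by simp
    also have "\<dots> \<le> card (orb x) * card (stabilizer F \<phi> x)"
      using le by simp
    finally show False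
      using eq by simp
  qed
  show "stabilizer F \<phi> y = stabilizer F \<phi> x" if "card (orb y) \<le> card (orb x)"
  proof (rule card_subset_eq[OF fin assms(3)])
    have "card (orb x) * card (stabilizer F \<phi> x) \<le> card (orb x) * card (stabilizer F \<phi> y)"
      using eq that by (metis mult_le_mono1)
    then show "card (stabilizer F \<phi> y) = card (stabilizer F \<phi> x)"
      using opos le by simp
  qed
qed

text \<open>Orbit size is lower semicontinuous: stabilizers of nearby points are smaller, so their
  orbits are at least as large.\<close>

lemma closedin_orbits_card_le: "closedin Q.mtopology {A \<in> Q. card A \<le> k}"
proof -
  have "openin Q.mtopology {A \<in> Q. k < card A}"
    unfolding Q.openin_mtopology
  proof (intro conjI allI impI)
    fix A assume "A \<in> {A \<in> Q. k < card A}"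
    then obtain x where x: "x \<in> Z" "A = orb x" "k < card (orb x)"
      using orbitsE by blast
    obtain e where e: "e > 0" "\<And>g. \<lbrakk>g \<in> carrier F; d (\<phi> g x) x < e\<rbrakk> \<Longrightarrow> \<phi> g x = x"
      using displacement_gap[OF x(1)] by metis
    have "k < card B" if B: "B \<in> Q" "orbit_dist A B < e / 2" for B
    proof -
      obtain y where y: "y \<in> B" "d x y < e / 2"
        using orbit_dist_less_iff[OF x(1) B(1), of "e / 2"] B(2) x(2) by blast
      obtain z where z: "z \<in> Z" "B = orb z"
        using B(1) by (rule orbitsE)
      have yZ: "B = orb y" "y \<in> Z"
        using orb_eq[OF z(1)] orb_subset[OF z(1)] y(1) z(2) by auto
      have "card (orb x) \<le> card (orb y)"
        using card_orb_antimono(1)[OF x(1) yZ(2) stabilizer_subset_near[OF x(1) yZ(2) e(2) y(2)]] .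
      then show ?thesis
        using x(3) yZ(1) by simp
    qed
    then show "\<exists>r>0. Q.mball A r \<subseteq> {A \<in> Q. k < card A}"
      using e(1) by (intro exI[of _ "e / 2"]) auto
  qed auto
  moreover have "Q - {A \<in> Q. card A \<le> k} = {A \<in> Q. k < card A}"
    by auto
  ultimately show ?thesis
    by (simp add: closedin_def)
qed

text \<open>Near \<open>x\<close> stabilizers can only shrink, so they are constant on the points whose orbit has at
  most as many elements as that of \<open>x\<close>; hence the orbit map is an isometry on such points.\<close>

lemma covering_dim_le_small_closed_in_stratum:
  assumes dim: "covering_dim_le mtopology n"
    and A: "A \<in> Q" "card A = Suc k"
  shows "\<exists>r>0. \<forall>B. closedin Q.mtopology B \<longrightarrow>
    B \<subseteq> Q.mball A r \<inter> {A \<in> Q. card A \<le> Suc k} \<longrightarrow> covering_dim_le (subtopology Q.mtopology B) n"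
proof -
  obtain x where x: "x \<in> Z" "A = orb x"
    using A(1) by (rule orbitsE)
  obtain e where e: "e > 0" "\<And>g. \<lbrakk>g \<in> carrier F; d (\<phi> g x) x < e\<rbrakk> \<Longrightarrow> \<phi> g x = x"
    using displacement_gap[OF x(1)] by metis
  \<comment> \<open>The radius \<open>e / 5\<close> leaves room for four such distances, which bound
    the displacement of \<open>x\<close> below, and it is less than the \<open>e / 2\<close> of
    \<open>stabilizer_subset_near\<close>.\<close>
  have "covering_dim_le (subtopology Q.mtopology B) n"
    if closedB: "closedin Q.mtopology B" and B: "B \<subseteq> Q.mball A (e / 5) \<inter> {A \<in> Q. card A \<le> Suc k}" for B
  proof -
    \<comment> \<open>The closed ball keeps \<open>B'\<close> closed, so it inherits the dimension
      bound; as \<open>B\<close> lies in the open ball of the same radius, each of its orbits still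
      has a point in \<open>B'\<close>.\<close>
    define B' where "B' = {y \<in> Z. orb y \<in> B} \<inter> mcball x (e / 5)"
    have "closedin mtopology B'"
      unfolding B'_def using closedin_continuous_map_preimage[OF continuous_map_orb closedB] by auto
    then have dimB': "covering_dim_le (subtopology mtopology B') n"
      using covering_dim_le_closed_subspace dim by blast
    have B'D: "y \<in> Z" "orb y \<in> B" "d x y \<le> e / 5" if "y \<in> B'" for y
      using that unfolding B'_def by auto
    have stab: "\<phi> g y = y" if y: "y \<in> B'" and g: "g \<in> carrier F" "\<phi> g x = x" for g y
    proof -
      have "card (orb y) \<le> card (orb x)"
        using B'D(2)[OF y] B A(2) x(2) by auto
      moreover have "d x y < e / 2"
        using B'D(3)[OF y] e(1) by simp
      ultimately have "stabilizer F \<phi> y = stabilizer F \<phi> x"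
        using card_orb_antimono(2)[OF x(1) B'D(1)[OF y]]
          stabilizer_subset_near[OF x(1) B'D(1)[OF y] e(2)] by blast
      then show ?thesis
        using g by (auto simp: stabilizer_def)
    qed
    \<comment> \<open>A point \<open>\<phi> g z\<close> of the orbit closest to \<open>y\<close>
      must be \<open>z\<close> itself: \<open>g\<close> moves \<open>x\<close> by less than
      \<open>e\<close>, hence fixes \<open>x\<close>, and therefore fixes \<open>z\<close>, whose
      stabilizer is that of \<open>x\<close>.\<close>
    have isom: "orbit_dist (orb y) (orb z) = d y z" if y: "y \<in> B'" and z: "z \<in> B'" for y z
    proof -
      note yZ = B'D(1)[OF y] and zZ = B'D(1)[OF z]
      obtain z' where z': "z' \<in> orb z" "z' \<in> Z" "orbit_dist (orb y) (orb z) = d y z'"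
        using orbit_dist_attained[OF yZ zZ] by metis
      obtain g where g: "g \<in> carrier F" "z' = \<phi> g z"
        using z'(1) unfolding orbit_def by auto
      have "d y z' \<le> d y z"
        using orbit_dist_le[OF yZ zZ orbit_refl[OF yZ] orbit_refl[OF zZ]] z'(3) by simp
      also have "\<dots> \<le> d x y + d x z"
        using triangle[OF yZ x(1) zZ] commute[of x y] by simp
      finally have yz': "d y z' \<le> d x y + d x z" .
      have gx: "\<phi> g x \<in> Z"
        using act_in[OF g(1) x(1)] .
      have "d (\<phi> g x) x \<le> d (\<phi> g x) z' + d z' y + d x y"
        using triangle[OF gx z'(2) x(1)] triangle[OF z'(2) yZ x(1)] commute[of x y] by linarith
      also have "\<dots> \<le> d x z + (d x y + d x z) + d x y"
        using isometric[OF g(1) x(1) zZ] g(2) yz' commute[of y z'] by simp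
      also have "\<dots> < e"
        using B'D(3)[OF y] B'D(3)[OF z] e(1) by simp
      finally have "\<phi> g x = x"
        using e(2)[OF g(1)] by simp
      then have "z' = z"
        using stab[OF z g(1)] g(2) by simp
      then show ?thesis
        using z'(3) by simp
    qed
    have "\<exists>y. y \<in> B' \<and> orb y = b" if b: "b \<in> B" for b
    proof -
      have bQ: "b \<in> Q" "orbit_dist (orb x) b < e / 5"
        using b B x(2) by auto
      then obtain y where y: "y \<in> b" "d x y < e / 5"
        using orbit_dist_less_iff[OF x(1)] by blast
      obtain z where z: "z \<in> Z" "b = orb z"
        using bQ(1) by (rule orbitsE)
      have "orb y = b" "y \<in> Z"
        using orb_eq[OF z(1)] orb_subset[OF z(1)] y(1) z(2) by auto
      then show ?thesis
        using y(2) b x(1) unfolding B'_def by auto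
    qed
    \<comment> \<open>This section of the orbit map over \<open>B\<close> is continuous because
      distances are preserved by \<open>isom\<close>.\<close>
    then obtain s where s: "\<And>b. b \<in> B \<Longrightarrow> s b \<in> B'" "\<And>b. b \<in> B \<Longrightarrow> orb (s b) = b"
      by metis
    have BQ: "B \<subseteq> Q" and B'Z: "B' \<subseteq> Z"
      using B unfolding B'_def by auto
    have "continuous_map (subtopology Q.mtopology B) mtopology s"
      unfolding continuous_map_def
    proof (intro conjI allI impI)
      show "s \<in> topspace (subtopology Q.mtopology B) \<rightarrow> topspace mtopology"
        using s(1) B'Z by auto
      fix V assume V: "openin mtopology V"
      have "\<exists>r>0. \<forall>c\<in>B. orbit_dist b c < r \<longrightarrow> s c \<in> V" if b: "b \<in> B" "s b \<in> V" for b
      proof -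
        obtain r where r: "r > 0" "mball (s b) r \<subseteq> V"
          using V b(2) unfolding openin_mtopology by metis
        have "s c \<in> V" if c: "c \<in> B" "orbit_dist b c < r" for c
        proof -
          have "d (s b) (s c) = orbit_dist b c"
            using isom[OF s(1)[OF b(1)] s(1)[OF c(1)]] s(2)[OF b(1)] s(2)[OF c(1)] by simp
          then have "s c \<in> mball (s b) r"
            using c s(1) B'Z b(1) by auto
          then show ?thesis
            using r(2) by blast
        qed
        then show ?thesis
          using r(1) by metis
      qed
      then obtain r where r: "\<And>b. b \<in> B \<Longrightarrow> s b \<in> V \<Longrightarrow> r b > 0"
          "\<And>b c. b \<in> B \<Longrightarrow> s b \<in> V \<Longrightarrow> c \<in> B \<Longrightarrow> orbit_dist b c < r b \<Longrightarrow> s c \<in> V"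
        by metis
      let ?O = "\<Union>b\<in>{b \<in> B. s b \<in> V}. Q.mball b (r b)"
      have "{b \<in> topspace (subtopology Q.mtopology B). s b \<in> V} = ?O \<inter> B"
      proof (intro equalityI subsetI)
        fix b assume "b \<in> {b \<in> topspace (subtopology Q.mtopology B). s b \<in> V}"
        then have b: "b \<in> B" "s b \<in> V"
          by auto
        then have "b \<in> Q.mball b (r b)"
          using r(1) BQ by auto
        then show "b \<in> ?O \<inter> B"
          using b by blast
      next
        fix c assume "c \<in> ?O \<inter> B"
        then obtain b where bc: "b \<in> B" "s b \<in> V" "orbit_dist b c < r b" "c \<in> B"
          by auto
        have "s c \<in> V"
          using r(2)[OF bc(1,2,4,3)] .
        then show "c \<in> {b \<in> topspace (subtopology Q.mtopology B). s b \<in> V}"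
          using bc(4) BQ by auto
      qed
      moreover have "openin Q.mtopology ?O"
        by (rule openin_Union) auto
      ultimately show "openin (subtopology Q.mtopology B) {b \<in> topspace (subtopology Q.mtopology B). s b \<in> V}"
        by (simp only: openin_subtopology_Int)
    qed
    then have "retraction_maps (subtopology mtopology B') (subtopology Q.mtopology B) orb s"
      unfolding retraction_maps_def
      using s B'D continuous_map_from_subtopology[OF continuous_map_orb, of B']
      by (auto simp: continuous_map_in_subtopology)
    then show ?thesis
      using covering_dim_le_retraction_maps dimB' by blast
  qed
  then show ?thesis
    using e(1) by (intro exI[of _ "e / 5"]) auto
qed

text \<open>The filtration by orbit size starts empty, as orbits are nonempty, and exhausts
  \<open>Q\<close> at the order of the group, so finitely many reductions suffice.\<close>

lemma orbit_space_open_shrinking: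
  assumes dim: "covering_dim_le mtopology n"
    and op: "\<And>i. openin Q.mtopology (U i)" and cov: "Q \<subseteq> (\<Union>i. U i)"
  obtains V where "\<And>i. openin Q.mtopology (V i)" "\<And>i. V i \<subseteq> U i" "Q \<subseteq> (\<Union>i. V i)"
    "\<And>A. A \<in> Q \<Longrightarrow> order_at_le V n A"
proof -
  let ?C = "\<lambda>k. {A \<in> Q. card A \<le> k}"
  have card: "0 < card A \<and> card A \<le> card (carrier F)" if A: "A \<in> Q" for A
  proof -
    obtain x where x: "x \<in> Z" "A = orb x"
      using A by (rule orbitsE)
    have "orb x = (\<lambda>g. \<phi> g x) ` carrier F"
      unfolding orbit_def by auto
    then have "card A \<le> card (carrier F)"
      using x(2) finite_carrier card_image_le by metis
    moreover have "0 < card A"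
      using x orbit_refl finite_orb by (auto simp: card_gt_0_iff)
    ultimately show ?thesis
      by simp
  qed
  have C0: "?C 0 = {}"
    using card by force
  have small: "\<exists>r>0. \<forall>B. closedin Q.mtopology B \<longrightarrow>
      B \<subseteq> Q.mball A r \<inter> ?C (Suc k) \<longrightarrow> covering_dim_le (subtopology Q.mtopology B) n"
    if "A \<in> ?C (Suc k) - ?C k" for k A
    by (rule covering_dim_le_small_closed_in_stratum[OF dim]) (use that in auto)
  have "\<exists>V. (\<forall>i. openin Q.mtopology (V i)) \<and> (\<forall>i. V i \<subseteq> U i) \<and> Q \<subseteq> (\<Union>i. V i) \<and>
      (\<forall>A\<in>?C (card (carrier F)). order_at_le V n A)"
    by (rule Q.open_shrinking_of_filtration[OF op cov C0 closedin_orbits_card_le small])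
  then obtain V where V: "\<forall>i. openin Q.mtopology (V i)" "\<forall>i. V i \<subseteq> U i" "Q \<subseteq> (\<Union>i. V i)"
      "\<forall>A\<in>?C (card (carrier F)). order_at_le V n A"
    by (elim exE conjE)
  show thesis
    using V card by (intro that[of V]) auto
qed

section \<open>Pulling the shrinking back to \<open>Z\<close>\<close>

lemma act_image_Int_preimage:
  assumes "g \<in> carrier F" "X \<subseteq> Z"
  shows "\<phi> g ` (X \<inter> {x \<in> Z. orb x \<in> V}) = \<phi> g ` X \<inter> {x \<in> Z. orb x \<in> V}"
proof (intro equalityI subsetI)
  fix y assume "y \<in> \<phi> g ` (X \<inter> {x \<in> Z. orb x \<in> V})"
  then show "y \<in> \<phi> g ` X \<inter> {x \<in> Z. orb x \<in> V}"
    using act_in[OF assms(1)] orb_act[OF assms(1)] by auto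
next
  fix y assume "y \<in> \<phi> g ` X \<inter> {x \<in> Z. orb x \<in> V}"
  then obtain x where "x \<in> X" "y = \<phi> g x" "orb y \<in> V"
    by auto
  then show "y \<in> \<phi> g ` (X \<inter> {x \<in> Z. orb x \<in> V})"
    using orb_act[OF assms(1), of x] assms(2) by auto
qed

lemma act_image_image:
  assumes "g \<in> carrier F" "h \<in> carrier F" "X \<subseteq> Z"
  shows "\<phi> h ` \<phi> g ` X = \<phi> (h \<otimes>\<^bsub>F\<^esub> g) ` X"
  unfolding image_image
  by (rule image_cong[OF refl]) (use composition_rule[OF _ assms(2,1)] assms(3) in auto)

text \<open>One representative \<open>R A\<close> is chosen for each image \<open>A\<close> in the orbit space: since the translates of
  \<open>R A\<close> are disjoint or equal, a point lies in at most one member of the refinement for each \<open>A\<close>.\<close>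

lemma open_G_refinement_exists:
  assumes dim: "covering_dim_le mtopology n"
    and op: "open_cover_of mtopology \<U>" and G: "G_cover F \<phi> Z \<U>"
  shows "\<exists>\<W>. open_cover_of mtopology \<W> \<and> G_refinement F \<phi> Z \<U> \<W> \<and> collection_dim_le \<W> n"
proof -
  interpret group F
    by (rule is_group)
  have \<U>open: "\<And>U. U \<in> \<U> \<Longrightarrow> openin mtopology U" and \<U>cov: "\<Union>\<U> = Z"
    using op by (auto simp: open_cover_of_def cover_of_def)
  have \<U>Z: "\<And>U. U \<in> \<U> \<Longrightarrow> U \<subseteq> Z"
    using \<U>cov by auto
  have \<U>act: "\<And>g U. g \<in> carrier F \<Longrightarrow> U \<in> \<U> \<Longrightarrow> \<phi> g ` U \<in> \<U>"
    and \<U>disj: "\<And>g U. g \<in> carrier F \<Longrightarrow> U \<in> \<U> \<Longrightarrow> \<phi> g ` U \<inter> U \<noteq> {} \<Longrightarrow> \<phi> g ` U = U"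
    using G by (auto simp: G_cover_def equivariant_cover_def)
  define \<A> where "\<A> = (\<lambda>U. orb ` U) ` \<U>"
  have "\<exists>U\<in>\<U>. orb ` U = A" if "A \<in> \<A>" for A
    using that unfolding \<A>_def by auto
  then obtain R where R: "\<And>A. A \<in> \<A> \<Longrightarrow> R A \<in> \<U>" "\<And>A. A \<in> \<A> \<Longrightarrow> orb ` R A = A"
    by metis
  \<comment> \<open>Indices that are not images of members of \<open>\<U>\<close> get the empty set,
    so only indices in \<open>\<A>\<close> survive in \<open>V\<close>.\<close>
  define P where "P = (\<lambda>A. if A \<in> \<A> then A else {})"
  have P_open: "openin Q.mtopology (P A)" for A
    using openin_orb_image \<U>open unfolding P_def \<A>_def by auto
  have P_cov: "Q \<subseteq> (\<Union>A. P A)"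
  proof
    fix a assume "a \<in> Q"
    then obtain x where x: "x \<in> Z" "a = orb x"
      by (rule orbitsE)
    then obtain U where U: "U \<in> \<U>" "x \<in> U"
      using \<U>cov by auto
    then have "a \<in> P (orb ` U)"
      using x unfolding P_def \<A>_def by auto
    then show "a \<in> (\<Union>A. P A)"
      by blast
  qed
  obtain V where V: "\<And>A. openin Q.mtopology (V A)" "\<And>A. V A \<subseteq> P A" "Q \<subseteq> (\<Union>A. V A)"
      "\<And>a. a \<in> Q \<Longrightarrow> order_at_le V n a"
    using orbit_space_open_shrinking[OF dim P_open P_cov] by metis
  \<comment> \<open>The second factor is invariant under the group, so the action permutes these
    sets as it permutes the translates of \<open>R A\<close>.\<close>
  define w where "w = (\<lambda>A g. \<phi> g ` R A \<inter> {x \<in> Z. orb x \<in> V A})"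
  define \<W> where "\<W> = {w A g | A g. A \<in> \<A> \<and> g \<in> carrier F}"
  have RZ: "R A \<subseteq> Z" if "A \<in> \<A>" for A
    using R(1)[OF that] \<U>Z by simp
  have w_act: "\<phi> h ` w A g = \<phi> h ` \<phi> g ` R A \<inter> {x \<in> Z. orb x \<in> V A}"
    if "A \<in> \<A>" "g \<in> carrier F" "h \<in> carrier F" for A g h
    unfolding w_def
    by (rule act_image_Int_preimage[OF that(3) \<U>Z[OF \<U>act[OF that(2) R(1)[OF that(1)]]]])
  have \<W>cov: "\<Union>\<W> = Z"
  proof (intro equalityI subsetI)
    fix x assume "x \<in> \<Union>\<W>"
    then show "x \<in> Z"
      unfolding \<W>_def w_def by auto
  next
    fix x assume x: "x \<in> Z"
    have "orb x \<in> (\<Union>A. V A)"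
      by (rule subsetD[OF V(3) in_orbits[OF x]])
    then obtain A where A: "orb x \<in> V A"
      by (rule UN_E)
    then have "orb x \<in> P A"
      by (rule subsetD[OF V(2)])
    then have A': "A \<in> \<A>" "orb x \<in> A"
      unfolding P_def by (auto split: if_splits)
    then obtain u where u: "u \<in> R A" "orb x = orb u"
      using R(2)[OF A'(1)] by auto
    have "x \<in> orb u"
      using u(2) orbit_refl[OF x] by simp
    then obtain g where g: "g \<in> carrier F" "x = \<phi> g u"
      unfolding orbit_def by auto
    have "x \<in> w A g"
      unfolding w_def using g(2) u(1) x A by auto
    then show "x \<in> \<Union>\<W>"
      unfolding \<W>_def using A'(1) g(1) by blast
  qed
  have W_open: "openin mtopology W" if W: "W \<in> \<W>" for W
  proof -
    obtain A g where Ag: "W = w A g" "A \<in> \<A>" "g \<in> carrier F"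
      using W unfolding \<W>_def by blast
    have "openin mtopology {x \<in> topspace mtopology. orb x \<in> V A}"
      using continuous_map_orb V(1) by (rule openin_continuous_map_preimage)
    then show ?thesis
      unfolding Ag(1) w_def using \<U>open[OF \<U>act[OF Ag(3) R(1)[OF Ag(2)]]] by auto
  qed
  have same: "\<phi> g ` R A = \<phi> h ` R A"
    if A: "A \<in> \<A>" and gh: "g \<in> carrier F" "h \<in> carrier F" and ne: "\<phi> g ` R A \<inter> \<phi> h ` R A \<noteq> {}" for A g h
  proof -
    have hg: "h \<otimes>\<^bsub>F\<^esub> inv\<^bsub>F\<^esub> g \<in> carrier F"
      using gh by simp
    have "\<phi> (h \<otimes>\<^bsub>F\<^esub> inv\<^bsub>F\<^esub> g) ` \<phi> g ` R A = \<phi> (h \<otimes>\<^bsub>F\<^esub> inv\<^bsub>F\<^esub> g \<otimes>\<^bsub>F\<^esub> g) ` R A"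
      using act_image_image[OF gh(1) hg RZ[OF A]] .
    also have "h \<otimes>\<^bsub>F\<^esub> inv\<^bsub>F\<^esub> g \<otimes>\<^bsub>F\<^esub> g = h"
      using gh by (simp add: m_assoc)
    finally have eq: "\<phi> (h \<otimes>\<^bsub>F\<^esub> inv\<^bsub>F\<^esub> g) ` \<phi> g ` R A = \<phi> h ` R A" .
    show ?thesis
      using \<U>disj[OF hg \<U>act[OF gh(1) R(1)[OF A]]] ne unfolding eq by blast
  qed
  have W_act: "\<phi> h ` W \<in> \<W> \<and> (\<phi> h ` W \<inter> W \<noteq> {} \<longrightarrow> \<phi> h ` W = W)"
    if W: "W \<in> \<W>" and h: "h \<in> carrier F" for W h
  proof -
    obtain A g where Ag: "W = w A g" "A \<in> \<A>" "g \<in> carrier F"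
      using W unfolding \<W>_def by blast
    have hg: "h \<otimes>\<^bsub>F\<^esub> g \<in> carrier F"
      using h Ag(3) by simp
    have eq: "\<phi> h ` W = w A (h \<otimes>\<^bsub>F\<^esub> g)"
      unfolding Ag(1) w_act[OF Ag(2,3) h] act_image_image[OF Ag(3) h RZ[OF Ag(2)]] by (simp add: w_def)
    have "w A (h \<otimes>\<^bsub>F\<^esub> g) = w A g" if "w A (h \<otimes>\<^bsub>F\<^esub> g) \<inter> w A g \<noteq> {}"
      using same[OF Ag(2) hg Ag(3)] that unfolding w_def by fastforce
    then show ?thesis
      using eq Ag hg unfolding \<W>_def by auto
  qed
  have W_dim: "finite {W \<in> \<W>. x \<in> W} \<and> card {W \<in> \<W>. x \<in> W} \<le> n + 1" for x
  proof (cases "x \<in> Z")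
    case False
    then have none: "{W \<in> \<W>. x \<in> W} = {}"
      using \<W>cov by auto
    show ?thesis
      unfolding none by simp
  next
    case True
    \<comment> \<open>By \<open>same\<close>, \<open>w A g\<close> does not depend on which
      \<open>g\<close> with \<open>x \<in> w A g\<close> is chosen, so the members through
      \<open>x\<close> are indexed by the \<open>A\<close> with
      \<open>orb x \<in> V A\<close>.\<close>
    define f where "f = (\<lambda>A. w A (SOME g. g \<in> carrier F \<and> x \<in> w A g))"
    have sub: "{W \<in> \<W>. x \<in> W} \<subseteq> f ` {A. orb x \<in> V A}"
    proof
      fix W assume "W \<in> {W \<in> \<W>. x \<in> W}"
      then obtain A g where Ag: "W = w A g" "A \<in> \<A>" "g \<in> carrier F" "x \<in> w A g"
        unfolding \<W>_def by blast
      define h where "h = (SOME g. g \<in> carrier F \<and> x \<in> w A g)"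
      have h: "h \<in> carrier F" "x \<in> w A h"
        using someI[of "\<lambda>g. g \<in> carrier F \<and> x \<in> w A g" g] Ag(3,4) unfolding h_def by auto
      have "\<phi> g ` R A = \<phi> h ` R A"
        using Ag(4) h(2) by (intro same[OF Ag(2,3) h(1)]) (auto simp: w_def)
      then have "W = f A"
        unfolding Ag(1) f_def h_def[symmetric] by (simp add: w_def)
      moreover have "orb x \<in> V A"
        using Ag(4) unfolding w_def by simp
      ultimately show "W \<in> f ` {A. orb x \<in> V A}"
        by simp
    qed
    have fin: "finite {A. orb x \<in> V A}" and le: "card {A. orb x \<in> V A} \<le> n + 1"
      using V(4)[OF in_orbits[OF True]] unfolding order_at_le_def by auto
    show ?thesis
      using sub fin le by (meson card_image_le card_mono finite_imageI finite_subset le_trans)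
  qed
  have "\<exists>U\<in>\<U>. W \<subseteq> U" if "W \<in> \<W>" for W
    using that \<U>act R(1) unfolding \<W>_def w_def by blast
  then show ?thesis
    using \<W>cov W_open W_act W_dim
    by (intro exI[of _ \<W>])
      (simp add: open_cover_of_def cover_of_def G_refinement_def refinement_of_def G_cover_def
        equivariant_cover_def collection_dim_le_def)
qed

end

theorem proposition2p6:
  fixes Z :: "'a set" and d :: "'a \<Rightarrow> 'a \<Rightarrow> real" and n :: nat
    and F :: "('g, 'm) monoid_scheme" and \<phi> :: "'g \<Rightarrow> 'a \<Rightarrow> 'a"
    and \<U> :: "'a set set"
  assumes "Metric_space Z d"
    and "covering_dim_le (Metric_space.mtopology Z d) n"
    and "group F" and "finite (carrier F)"
    and "isometric_action F Z d \<phi>"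
    and "open_cover_of (Metric_space.mtopology Z d) \<U>" and "G_cover F \<phi> Z \<U>"
  shows "\<exists>\<W>. open_cover_of (Metric_space.mtopology Z d) \<W> \<and>
             G_refinement F \<phi> Z \<U> \<W> \<and> collection_dim_le \<W> n"
proof -
  interpret finite_isometric_action Z d F \<phi>
    using assms(1,4,5)
    by (auto simp: finite_isometric_action_def finite_isometric_action_axioms_def
        isometric_action_def)
  show ?thesis
    using assms(2,6,7) by (rule open_G_refinement_exists)
qed

end
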